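(* Let $r\ge0$ be an integer and let $F_r=F_r(L,M,D,P,\Gamma,\Delta)$ be the class of pairs $(f,\eta)$ defined in the context. For any constants $\hat K$ and $\hat K_1$ there exist positive $\hat C$, $n_0$ and $\hat N$ such that for any $n\ge n_0$ and $N\ge\hat N$, for any information $\mathcal N_{n,N}$ (with constant truncation parameter $N$, based on at most $\hat K n$ information points and on a partition $a=t_0<\dots<t_n=b$ with $\max_k(t_{k+1}-t_k)\le\alpha(n)$, where $\alpha(n)\le\hat K_1n^{-1}$) and any algorithm $\phi_{n,N}$ using $\mathcal N_{n,N}$, it holds $$e(\phi_{n,N},\mathcal N_{n,N},F_r)\ge\hat C\bigl(\gamma(N)+\delta(N)+n^{-\max\{r,1\}}\bigr).$$
   Context: **Space.** $(E,\|\cdot\|)$ is an infinite-dimensional real Banach space with a Schauder basis $\{e_1,e_2,\dots\}$, $\|e_j\|=1$. For $y=\sum_j y^je_j$ put $P_ky=\sum_{j=1}^k y^je_j$, and let $P=\sup_k\|P_k\|<\infty$. For $f:E\to E$ write $f(y)=\sum_j f^j(y)e_j$. Let $a<b$. For Lipschitz $f$ and $\eta\in E$, $z:[a,b]\to E$ denotes the unique solution of $z'(t)=f(z(t))$, $z(a)=\eta$. **Class $F_r$.** Let $L,M,D>0$ and let $\Gamma=\{\gamma(k)\}_{k\ge1}$, $\Delta=\{\delta(k)\}_{k\ge1}$ be positive, nonincreasing sequences convergent to zero. Consider pairs $(f,\eta)$ with (A1) $\|\eta-P_k\eta\|\le\gamma(k)$ for $k\in\mathbb N$; (A2) $\|f(y)-f(\bar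 y)\|\le L\|y-\bar y\|$ for $y,\bar y\in E$; (A3) $\|f(\eta)\|\le M$. Let $R$ be a fixed number, depending only on $L,M,\gamma(1),P,a,b$, such that for all pairs satisfying (A1)–(A3) the solution $z$ stays in $K=K(\eta,R)=\{y\in E:\|y-\eta\|\le R\}$ on $[a,b]$, and, for all sufficiently fine partitions, so do the local solutions $\bar z_k$ of the following algorithm. Algorithm $\phi^*_{n,\vec N}$ (partition $a=t_0<\dots<t_n=b$, $h_k=t_{k+1}-t_k$, $\vec N=[N_{-1},\dots,N_{n-1}]$): $\bar f_k=P_{N_k}f$, $\bar y_0=P_{N_{-1}}\eta$; given $\bar y_k$, set $\bar l_{k,0}\equiv\bar y_k$ and, for $s=0,\dots,\max\{r,1\}-1$, $\bar l_{k,s+1}(t)=\bar y_k+\int_{t_k}^t\bar q_{k,s}(\xi)d\xi$, where $\bar q_{k,s}$ is the Lagrange polynomial of degree at most $s$ interpolating $\bar f_k(\bar l_{k,s}(\cdot))$ at $t_k+ph_k/s$, $p=0,\dots,s$ (at $t_k$ if $s=0$); $\bar y_{k+1}=\bar l_{k,\max\{r,1\}}(t_{k+1})$; and $\bar z_k'=\bar f_k(\bar z_k)$ on $[t_k,t_{k+1}]$, $\bar z_k(t_k)=\bar y_k$. ("Sufficiently fine": for each nonincreasing $\alpha(n)\to0$ there is $\hat n$ such that the property holds for all $n\ge\hat n$, all partitions with $\max_kh_k\le\alpha(n)$, all $\vec N$ and all $(f,\eta)$ satisfying (A1)–(A3). Such an $R$ exists.) The class $F_r$ consists of all pairs satisfying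 (A1)–(A3) and (A4) $f\in C^r(K)$ (Fréchet derivatives) and $\sup_{y\in K}\|f^{(l)}(y)\|\le D$ for $l=1,\dots,r$; (A5) $\sup_{y\in K}\|f(y)-P_kf(y)\|\le\delta(k)$ for $k\in\mathbb N$. **Information and algorithms with constant truncation parameter $N$.** A nonincreasing sequence $\{\alpha(n)\}$ convergent to $0$ with $\alpha(n)\le\hat K_1n^{-1}$ is given, and for each $n$ the partition $a=t_0<\dots<t_n=b$ is fixed in advance and satisfies $\max_k(t_{k+1}-t_k)\le\alpha(n)$. The information $\mathcal N_{n,N}(f,\eta)$ consists of $P_N\eta$ together with finitely many evaluations of real numbers, each being the value of a component $f^j(P_Ny)$, $1\le j\le N$, or of a partial derivative of order at most $r$ (with respect to the first $N$ coordinates) of $f^j$ at $P_Ny$, for some information point $y$. The total number of information points is at most $\hat Kn$. The information is adaptive: information points, indices $j$ and orders of partial derivatives may be chosen successively on the basis of the information computed so far. An algorithm $\phi_{n,N}$ is a mapping assigning to the vector $\mathcal N_{n,N}(f,\eta)$ a function $l:[a,b]\to E$ (composed of pieces $l_k$ on $[t_k,t_{k+1}]$). Its worst-case error is $$e(\phi_{n,N},\mathcal N_{n,N},F_r)=\sup_{(f,\eta)\in F_r}\ \sup_{t\in[a,b]}\|z(t)-l(t)\|.$$ *)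

theory Defs
  imports "HOL-Analysis.Analysis"
begin

section \<open>Schauder bases\<close>

text \<open>
  Basis vectors and coordinates are numbered from 0: \<open>e j\<close> and \<open>coord e y j\<close> are the
  (j+1)-st basis vector and coordinate.  Hence \<open>proj e k\<close> is the projection onto the first
  \<open>k\<close> basis vectors, with \<open>k\<close> itself unshifted.  A space with such a basis is automatically
  infinite-dimensional, since unique expansions make all the \<open>e j\<close> linearly independent.
\<close>

definition schauder_basis :: "(nat \<Rightarrow> 'a::banach) \<Rightarrow> bool" where
  "schauder_basis e \<longleftrightarrow> (\<forall>y. \<exists>!c::nat \<Rightarrow> real. (\<lambda>j. c j *\<^sub>R e j) sums y)"

definition coord :: "(nat \<Rightarrow> 'a::banach) \<Rightarrow> 'a \<Rightarrow> nat \<Rightarrow> real" where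
  "coord e y = (THE c. (\<lambda>j. c j *\<^sub>R e j) sums y)"

definition proj :: "(nat \<Rightarrow> 'a::banach) \<Rightarrow> nat \<Rightarrow> 'a \<Rightarrow> 'a" where
  "proj e k y = (\<Sum>j<k. coord e y j *\<^sub>R e j)"

text \<open>
  \<open>P\<close> is the finite supremum of the operator norms of the projections.  Boundedness of each
  projection is stated separately because \<open>onorm\<close> is meaningful for bounded maps only; in a
  Banach space all of this except the value of \<open>P\<close> follows from \<open>schauder_basis e\<close>.
\<close>

definition basis_constant :: "(nat \<Rightarrow> 'a::banach) \<Rightarrow> real \<Rightarrow> bool" where
  "basis_constant e P \<longleftrightarrow>
     (\<forall>k\<ge>1. bounded_linear (proj e k)) \<and>
     bdd_above ((\<lambda>k. onorm (proj e k)) ` {1..}) \<and>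
     P = (SUP k\<in>{1..}. onorm (proj e k))"

section \<open>Sequences, partitions, initial value problems\<close>

text \<open>Sequences are indexed by positive integers; the entry at index 0 plays no role.\<close>

definition nonincreasing_null :: "(nat \<Rightarrow> real) \<Rightarrow> bool" where
  "nonincreasing_null s \<longleftrightarrow> (\<forall>k\<ge>1. s (Suc k) \<le> s k) \<and> s \<longlonglongrightarrow> 0"

definition positive_seq :: "(nat \<Rightarrow> real) \<Rightarrow> bool" where
  "positive_seq s \<longleftrightarrow> (\<forall>k\<ge>1. 0 < s k)"

definition is_partition :: "real \<Rightarrow> real \<Rightarrow> nat \<Rightarrow> (nat \<Rightarrow> real) \<Rightarrow> bool" where
  "is_partition a b n t \<longleftrightarrow> t 0 = a \<and> t n = b \<and> (\<forall>k<n. t k < t (Suc k))"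

definition mesh_le :: "nat \<Rightarrow> (nat \<Rightarrow> real) \<Rightarrow> real \<Rightarrow> bool" where
  "mesh_le n t d \<longleftrightarrow> (\<forall>k<n. t (Suc k) - t k \<le> d)"

definition ivp_sol :: "('a::banach \<Rightarrow> 'a) \<Rightarrow> real \<Rightarrow> real \<Rightarrow> 'a \<Rightarrow> (real \<Rightarrow> 'a) \<Rightarrow> bool" where
  "ivp_sol f a b \<eta> z \<longleftrightarrow>
     z a = \<eta> \<and> (\<forall>t\<in>{a..b}. (z has_vector_derivative f (z t)) (at t within {a..b}))"

section \<open>Frechet derivatives of higher order\<close>

text \<open>An \<open>l\<close>-linear map is represented by its action on argument lists of length \<open>l\<close>.\<close>

definition bounded_multilinear :: "nat \<Rightarrow> ('a::real_normed_vector list \<Rightarrow> 'a) \<Rightarrow> bool" where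
  "bounded_multilinear l T \<longleftrightarrow>
     (\<forall>vs. length vs = l \<longrightarrow> (\<forall>i<l. linear (\<lambda>v. T (vs[i := v])))) \<and>
     (\<exists>B. \<forall>vs. length vs = l \<longrightarrow> norm (T vs) \<le> B * prod_list (map norm vs))"

definition mnorm :: "nat \<Rightarrow> ('a::real_normed_vector list \<Rightarrow> 'a) \<Rightarrow> real" where
  "mnorm l T = (SUP vs\<in>{vs. length vs = l \<and> (\<forall>v\<in>set vs. norm v \<le> 1)}. norm (T vs))"

text \<open>
  \<open>G l y\<close> is the \<open>l\<close>-th derivative of \<open>f\<close> at \<open>y\<close>, the direction of the last differentiation
  being the head of the list.  Differentiability and continuity of \<open>G l\<close> refer to the operator
  norm \<open>mnorm l\<close>, and are relative to \<open>K\<close>.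
\<close>

definition frechet_derivatives ::
    "nat \<Rightarrow> 'a::real_normed_vector set \<Rightarrow> ('a \<Rightarrow> 'a) \<Rightarrow> (nat \<Rightarrow> 'a \<Rightarrow> 'a list \<Rightarrow> 'a) \<Rightarrow> bool" where
  "frechet_derivatives r K f G \<longleftrightarrow>
     (\<forall>y\<in>K. G 0 y [] = f y) \<and>
     (\<forall>l\<le>r. \<forall>y\<in>K. bounded_multilinear l (G l y)) \<and>
     (\<forall>l<r. \<forall>y\<in>K.
        ((\<lambda>x. mnorm l (\<lambda>vs. G l x vs - G l y vs - G (Suc l) y ((x - y) # vs)) / norm (x - y))
          \<longlongrightarrow> 0) (at y within K)) \<and>
     (\<forall>l\<le>r. \<forall>y\<in>K. ((\<lambda>x. mnorm l (\<lambda>vs. G l x vs - G l y vs)) \<longlongrightarrow> 0) (at y within K))"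

section \<open>The algorithm with truncation parameters varying from step to step\<close>

definition lagrange_interpol :: "nat \<Rightarrow> (nat \<Rightarrow> real) \<Rightarrow> (nat \<Rightarrow> 'a::banach) \<Rightarrow> real \<Rightarrow> 'a" where
  "lagrange_interpol s x v \<xi> =
     (\<Sum>p\<le>s. (\<Prod>i\<in>{..s} - {p}. (\<xi> - x i) / (x p - x i)) *\<^sub>R v p)"

definition interpol_node :: "real \<Rightarrow> real \<Rightarrow> nat \<Rightarrow> nat \<Rightarrow> real" where
  "interpol_node t0 h s p = (if s = 0 then t0 else t0 + real p * h / real s)"

primrec local_approx :: "('a::banach \<Rightarrow> 'a) \<Rightarrow> real \<Rightarrow> real \<Rightarrow> 'a \<Rightarrow> nat \<Rightarrow> real \<Rightarrow> 'a" where
  "local_approx g t0 h y 0 = (\<lambda>t. y)"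
| "local_approx g t0 h y (Suc s) =
     (\<lambda>t. y + integral {t0..t}
        (lagrange_interpol s (interpol_node t0 h s)
           (\<lambda>p. g (local_approx g t0 h y s (interpol_node t0 h s p)))))"

text \<open>
  The truncation vector with entries numbered -1, 0, ..., n-1 is shifted by one: \<open>Ns 0\<close> truncates
  the initial value, \<open>Ns (Suc k)\<close> truncates the right-hand side in step \<open>k\<close>.
\<close>

definition trunc_rhs ::
    "(nat \<Rightarrow> 'a::banach) \<Rightarrow> ('a \<Rightarrow> 'a) \<Rightarrow> (nat \<Rightarrow> nat) \<Rightarrow> nat \<Rightarrow> 'a \<Rightarrow> 'a" where
  "trunc_rhs e f Ns k = (\<lambda>x. proj e (Ns (Suc k)) (f x))"

primrec approx_values ::
    "(nat \<Rightarrow> 'a::banach) \<Rightarrow> nat \<Rightarrow> ('a \<Rightarrow> 'a) \<Rightarrow> 'a \<Rightarrow> (nat \<Rightarrow> real) \<Rightarrow> (nat \<Rightarrow> nat) \<Rightarrow> nat \<Rightarrow> 'a" where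
  "approx_values e r f \<eta> t Ns 0 = proj e (Ns 0) \<eta>"
| "approx_values e r f \<eta> t Ns (Suc k) =
     local_approx (trunc_rhs e f Ns k) (t k) (t (Suc k) - t k)
       (approx_values e r f \<eta> t Ns k) (max r 1) (t (Suc k))"

section \<open>The class of problems\<close>

definition basic_conditions ::
    "(nat \<Rightarrow> 'a::banach) \<Rightarrow> real \<Rightarrow> real \<Rightarrow> (nat \<Rightarrow> real) \<Rightarrow> ('a \<Rightarrow> 'a) \<Rightarrow> 'a \<Rightarrow> bool" where
  "basic_conditions e L M \<gamma> f \<eta> \<longleftrightarrow>
     (\<forall>k\<ge>1. norm (\<eta> - proj e k \<eta>) \<le> \<gamma> k) \<and>
     (\<forall>y y'. norm (f y - f y') \<le> L * norm (y - y')) \<and>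
     norm (f \<eta>) \<le> M"

text \<open>
  \<open>R\<close> is a radius such that the solutions and, for fine partitions, the local solutions of the
  algorithm above remain in the closed ball around the initial value.  Truncation parameters are
  at least 1.
\<close>

definition confining_radius ::
    "(nat \<Rightarrow> 'a::banach) \<Rightarrow> nat \<Rightarrow> real \<Rightarrow> real \<Rightarrow> real \<Rightarrow> real \<Rightarrow> (nat \<Rightarrow> real) \<Rightarrow> real \<Rightarrow> bool" where
  "confining_radius e r a b L M \<gamma> R \<longleftrightarrow>
     (\<forall>f \<eta> z. basic_conditions e L M \<gamma> f \<eta> \<and> ivp_sol f a b \<eta> z \<longrightarrow>
        (\<forall>s\<in>{a..b}. z s \<in> cball \<eta> R)) \<and>
     (\<forall>\<alpha>. nonincreasing_null \<alpha> \<longrightarrow>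
        (\<exists>n1. \<forall>n\<ge>n1. \<forall>t Ns f \<eta>.
           is_partition a b n t \<and> mesh_le n t (\<alpha> n) \<and> (\<forall>k\<le>n. 1 \<le> Ns k) \<and>
           basic_conditions e L M \<gamma> f \<eta> \<longrightarrow>
             (\<forall>k<n. \<forall>z.
                ivp_sol (trunc_rhs e f Ns k) (t k) (t (Suc k)) (approx_values e r f \<eta> t Ns k) z \<longrightarrow>
                (\<forall>s\<in>{t k..t (Suc k)}. z s \<in> cball \<eta> R))))"

definition problem_class ::
    "(nat \<Rightarrow> 'a::banach) \<Rightarrow> nat \<Rightarrow> real \<Rightarrow> real \<Rightarrow> real \<Rightarrow> (nat \<Rightarrow> real) \<Rightarrow> (nat \<Rightarrow> real) \<Rightarrow> real
      \<Rightarrow> (('a \<Rightarrow> 'a) \<times> 'a) set" where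
  "problem_class e r L M D \<gamma> \<delta> R =
     {(f, \<eta>). basic_conditions e L M \<gamma> f \<eta> \<and>
        (\<exists>G. frechet_derivatives r (cball \<eta> R) f G \<and>
             (\<forall>l\<in>{1..r}. \<forall>y\<in>cball \<eta> R. mnorm l (G l y) \<le> D)) \<and>
        (\<forall>k\<ge>1. \<forall>y\<in>cball \<eta> R. norm (f y - proj e k (f y)) \<le> \<delta> k)}"

section \<open>Adaptive information and algorithms\<close>

text \<open>
  The list \<open>js\<close> names the coordinates of an iterated partial derivative; the empty list gives the
  function itself.  As usual for \<open>deriv\<close>, the value is unspecified where a derivative does not exist.
\<close>

primrec partial_deriv ::
    "(nat \<Rightarrow> 'a::banach) \<Rightarrow> nat list \<Rightarrow> ('a \<Rightarrow> real) \<Rightarrow> 'a \<Rightarrow> real" where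
  "partial_deriv e [] g x = g x"
| "partial_deriv e (i # js) g x = deriv (\<lambda>s. partial_deriv e js g (x + s *\<^sub>R e i)) 0"

text \<open>
  A query consists of an information point, the index of a component and a list of differentiation
  coordinates.
\<close>

type_synonym 'a evaluation = "'a \<times> nat \<times> nat list"

fun eval_result ::
    "(nat \<Rightarrow> 'a::banach) \<Rightarrow> nat \<Rightarrow> ('a \<Rightarrow> 'a) \<Rightarrow> 'a evaluation \<Rightarrow> real" where
  "eval_result e N f (y, j, js) = partial_deriv e js (\<lambda>x. coord e (f x) j) (proj e N y)"

text \<open>
  An adaptive strategy is a decision tree branching over the real result of each evaluation.  Being
  a datatype, it performs finitely many evaluations whatever the results are.
\<close>

datatype 'a strategy = Stop | Query "'a evaluation" "real \<Rightarrow> 'a strategy"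

primrec strategy_queries ::
    "(nat \<Rightarrow> 'a::banach) \<Rightarrow> nat \<Rightarrow> ('a \<Rightarrow> 'a) \<Rightarrow> 'a strategy \<Rightarrow> 'a evaluation list" where
  "strategy_queries e N f Stop = []"
| "strategy_queries e N f (Query q next) =
     q # strategy_queries e N f (next (eval_result e N f q))"

text \<open>
  The strategy may depend on the truncated initial value, the first entry of the information.
\<close>

definition information ::
    "(nat \<Rightarrow> 'a::banach) \<Rightarrow> nat \<Rightarrow> ('a \<Rightarrow> 'a strategy) \<Rightarrow> ('a \<Rightarrow> 'a) \<Rightarrow> 'a \<Rightarrow> 'a \<times> real list" where
  "information e N S f \<eta> =
     (proj e N \<eta>, map (eval_result e N f) (strategy_queries e N f (S (proj e N \<eta>))))"

definition admissible_information ::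
    "(nat \<Rightarrow> 'a::banach) \<Rightarrow> nat \<Rightarrow> nat \<Rightarrow> real \<Rightarrow> (('a \<Rightarrow> 'a) \<times> 'a) set \<Rightarrow> ('a \<Rightarrow> 'a strategy) \<Rightarrow> bool" where
  "admissible_information e r N m F S \<longleftrightarrow>
     (\<forall>(f, \<eta>)\<in>F. let Q = set (strategy_queries e N f (S (proj e N \<eta>))) in
        (\<forall>(y, j, js)\<in>Q. j < N \<and> length js \<le> r \<and> set js \<subseteq> {..<N}) \<and>
        real (card (fst ` Q)) \<le> m)"

text \<open>
  An algorithm maps the information to pieces \<open>l k\<close> on the subintervals.  At an interior partition
  point the piece to the right is used; taking all pieces equal yields an arbitrary function.
\<close>

definition compose_pieces :: "nat \<Rightarrow> (nat \<Rightarrow> real) \<Rightarrow> (nat \<Rightarrow> real \<Rightarrow> 'a) \<Rightarrow> real \<Rightarrow> 'a" where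
  "compose_pieces n t l s = l (GREATEST k. k < n \<and> t k \<le> s) s"

definition worst_case_error ::
    "(nat \<Rightarrow> 'a::banach) \<Rightarrow> real \<Rightarrow> real \<Rightarrow> nat \<Rightarrow> (nat \<Rightarrow> real) \<Rightarrow> nat \<Rightarrow> (('a \<Rightarrow> 'a) \<times> 'a) set
      \<Rightarrow> ('a \<Rightarrow> 'a strategy) \<Rightarrow> ('a \<times> real list \<Rightarrow> nat \<Rightarrow> real \<Rightarrow> 'a) \<Rightarrow> ereal" where
  "worst_case_error e a b n t N F S \<phi> =
     Sup {ereal (norm (z s - compose_pieces n t (\<phi> (information e N S f \<eta>)) s)) | f \<eta> z s.
            (f, \<eta>) \<in> F \<and> ivp_sol f a b \<eta> z \<and> s \<in> {a..b}}"

end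

theory Submission
  imports Defs
begin

text \<open>
  Each of the three terms comes from a pair of problems in the class that yield the same
  information although their solutions differ by at least a constant times that term.  The
  algorithm answers both problems with the same function, so it errs by at least half the distance
  of the solutions on one of them (\<open>worst_case_error_ge_half_distance\<close>).

  The first two pairs live in the direction \<open>e N\<close>, which truncation after \<open>N\<close> coordinates makes
  invisible: the zero right-hand side with initial values \<open>\<plusminus>\<gamma>(N) e\<^sub>N\<close>, whose constant solutions are
  \<open>2\<gamma>(N)\<close> apart, and the initial value 0 with constant right-hand sides \<open>\<plusminus>c \<delta>(N) e\<^sub>N\<close>, whose
  solutions drift apart linearly.

  The third pair is \<open>f(y) = c e\<^sub>0\<close> and \<open>g(y) = c e\<^sub>0 + H(y\<^sub>0) e\<^sub>1\<close> with initial value 0.  The coordinate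
  \<open>y\<^sub>0\<close> acts as a clock running at speed \<open>c\<close>, so the problem for \<open>g\<close> is a quadrature problem whose
  solution is explicit: its coordinate 1 is \<open>\<integral>H(c(s-a)) ds\<close>.  Put \<open>q = max r 1\<close>.  Of \<open>2m\<close> disjoint cells on the clock axis, the at most \<open>m = Kn\<close>
  information points used for \<open>f\<close> leave \<open>m\<close> cells untouched.  On every untouched cell \<open>H\<close> is a bump
  as wide as the cell, of width \<open>w\<close> proportional to \<open>1/n\<close>, and of height proportional to \<open>w\<^sup>q\<close>; this
  keeps the derivatives of \<open>H\<close> up to order \<open>q\<close> uniformly bounded, so that \<open>g\<close> is in the class.  As
  \<open>g\<close> agrees with \<open>f\<close> near all information points, the adaptive strategy proceeds identically on
  both.  All bumps are nonnegative and together occupy a fixed proportion of the clock axis, so the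
  integral of \<open>H\<close> is of order \<open>w\<^sup>q\<close>, that is, of order \<open>n\<close> to the power \<open>-q\<close>.

  The derivative and truncation bounds of all these problems hold on the whole space, hence on the
  ball around the initial value on which the class imposes them.
\<close>

section \<open>Coordinates with respect to a normalized Schauder basis\<close>

lemma coord_sums:
  assumes "schauder_basis e"
  shows "(\<lambda>j. coord e y j *\<^sub>R e j) sums y"
  using assms theI'[of "\<lambda>c. (\<lambda>j. c j *\<^sub>R e j) sums y"]
  unfolding schauder_basis_def coord_def by blast

lemma coord_eqI:
  assumes "schauder_basis e" "(\<lambda>j. c j *\<^sub>R e j) sums y"
  shows "coord e y = c"
  using assms coord_sums[OF assms(1), of y] unfolding schauder_basis_def by blast

lemma linear_coord:
  assumes "schauder_basis e"
  shows "linear (\<lambda>y. coord e y j)"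
proof (rule linearI)
  fix x y
  have "(\<lambda>j. (coord e x j + coord e y j) *\<^sub>R e j) sums (x + y)"
    using sums_add[OF coord_sums[OF assms, of x] coord_sums[OF assms, of y]]
    by (simp add: scaleR_add_left)
  from coord_eqI[OF assms this] show "coord e (x + y) j = coord e x j + coord e y j" by simp
next
  fix c x
  have "(\<lambda>j. (c * coord e x j) *\<^sub>R e j) sums (c *\<^sub>R x)"
    using bounded_linear.sums[OF bounded_linear_scaleR_right coord_sums[OF assms, of x], of c]
    by simp
  from coord_eqI[OF assms this] show "coord e (c *\<^sub>R x) j = c *\<^sub>R coord e x j" by simp
qed

lemma coord_basis:
  assumes "schauder_basis e"
  shows "coord e (e i) j = (if i = j then 1 else 0)"
proof -
  have "(\<lambda>j. if j = i then e j else 0) sums e i"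
    by (rule sums_single)
  moreover have "(\<lambda>j. if j = i then e j else 0) = (\<lambda>j. (if i = j then 1 else 0) *\<^sub>R e j)"
    by auto
  ultimately have "coord e (e i) = (\<lambda>j. if i = j then 1 else 0)"
    by (intro coord_eqI[OF assms]) simp
  then show ?thesis by simp
qed

lemma coord_add:
  assumes "schauder_basis e"
  shows "coord e (x + y) j = coord e x j + coord e y j"
  using linear_add[OF linear_coord[OF assms]] by simp

lemma coord_scaleR:
  assumes "schauder_basis e"
  shows "coord e (c *\<^sub>R y) j = c * coord e y j"
  using linear_cmul[OF linear_coord[OF assms]] by simp

lemma linear_proj:
  assumes "schauder_basis e"
  shows "linear (proj e k)"
  by (rule linearI)
     (simp_all add: proj_def coord_add[OF assms] coord_scaleR[OF assms] scaleR_add_left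
        sum.distrib scaleR_sum_right)

lemma proj_basis:
  assumes "schauder_basis e"
  shows "proj e k (c *\<^sub>R e i) = (if i < k then c *\<^sub>R e i else 0)"
proof -
  have "proj e k (c *\<^sub>R e i) = (\<Sum>j<k. if j = i then c *\<^sub>R e i else 0)"
    unfolding proj_def
    by (rule sum.cong) (auto simp: coord_scaleR[OF assms] coord_basis[OF assms])
  then show ?thesis by simp
qed

text \<open>
  The first projection is rank one with unit image vector, so its boundedness is that of the first
  coordinate functional.
\<close>

lemma coord_first_bounded:
  fixes e :: "nat \<Rightarrow> 'a::banach"
  assumes "schauder_basis e" "norm (e 0) = 1" "basis_constant e P"
  shows "\<exists>B\<ge>0. \<forall>y. \<bar>coord e y 0\<bar> \<le> B * norm y"
proof -
  have bl: "bounded_linear (proj e 1)"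
    using assms(3) unfolding basis_constant_def by blast
  have "\<bar>coord e y 0\<bar> = norm (proj e 1 y)" for y
    by (simp add: proj_def assms(2))
  then show ?thesis
    using onorm[OF bl] onorm_pos_le[OF bl] by metis
qed

section \<open>Problems that an adaptive strategy cannot tell apart\<close>

text \<open>
  An adaptive strategy can separate two functions only by an answer in which they differ.  It is
  enough to compare the answers to the queries made for one of the two functions, since both runs
  follow the same branch until the first difference.
\<close>

lemma strategy_queries_cong:
  assumes "\<And>q. q \<in> set (strategy_queries e N f S) \<Longrightarrow> eval_result e N f q = eval_result e N g q"
  shows "strategy_queries e N g S = strategy_queries e N f S"
  using assms
proof (induction S)
  case Stop
  then show ?case by simp
next
  case (Query q nxt)
  have *: "eval_result e N g q = eval_result e N f q"
    using Query.prems[of q] by simp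
  have "strategy_queries e N g (nxt (eval_result e N f q))
      = strategy_queries e N f (nxt (eval_result e N f q))"
    by (rule Query.IH) (use Query.prems in auto)
  with * show ?case by simp
qed

lemma information_cong:
  assumes "proj e N \<eta> = proj e N \<eta>'"
    and "\<And>q. q \<in> set (strategy_queries e N f (S (proj e N \<eta>)))
          \<Longrightarrow> eval_result e N f q = eval_result e N g q"
  shows "information e N S f \<eta> = information e N S g \<eta>'"
proof -
  have "strategy_queries e N g (S (proj e N \<eta>')) = strategy_queries e N f (S (proj e N \<eta>))"
    using strategy_queries_cong[of e N f "S (proj e N \<eta>)" g] assms by simp
  then show ?thesis
    using assms unfolding information_def by simp
qed

text \<open>
  The algorithm returns the same function for two problems with the same information, and by the
  triangle inequality no function is closer to both solutions than half their distance.
\<close>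

lemma worst_case_error_ge_half_distance:
  assumes "(f, \<eta>) \<in> F" "(g, \<eta>') \<in> F"
    and "information e N S f \<eta> = information e N S g \<eta>'"
    and "ivp_sol f a b \<eta> z" "ivp_sol g a b \<eta>' z'"
    and "s \<in> {a..b}"
  shows "ereal (norm (z s - z' s) / 2) \<le> worst_case_error e a b n t N F S \<phi>"
proof -
  let ?l = "compose_pieces n t (\<phi> (information e N S f \<eta>)) s"
  let ?E = "worst_case_error e a b n t N F S \<phi>"
  have 1: "ereal (norm (z s - ?l)) \<le> ?E"
    unfolding worst_case_error_def using assms by (intro Sup_upper) blast
  have 2: "ereal (norm (z' s - ?l)) \<le> ?E"
    unfolding worst_case_error_def
    by (intro Sup_upper CollectI exI[of _ g] exI[of _ \<eta>'] exI[of _ z'] exI[of _ s])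
       (use assms in simp)
  have "norm (z s - z' s) \<le> norm (z s - ?l) + norm (z' s - ?l)"
    using norm_triangle_ineq4[of "z s - ?l" "z' s - ?l"] by simp
  then have "norm (z s - z' s) / 2 \<le> max (norm (z s - ?l)) (norm (z' s - ?l))"
    by linarith
  then have "ereal (norm (z s - z' s) / 2)
      \<le> ereal (max (norm (z s - ?l)) (norm (z' s - ?l)))"
    by (simp only: ereal_less_eq)
  also have "\<dots> \<le> ?E"
    using 1 2 by (simp add: max_def)
  finally show ?thesis .
qed

text \<open>
  Partial derivatives of any order are determined by the values near the point; hence functions
  that agree on an open set give the same answers there, whatever order is asked for, and even
  where a derivative does not exist.
\<close>

lemma partial_deriv_cong_open:
  assumes "open W" "\<And>x. x \<in> W \<Longrightarrow> g x = h x" "x \<in> W"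
  shows "partial_deriv e js g x = partial_deriv e js h x"
  using assms(3)
proof (induction js arbitrary: x)
  case Nil
  then show ?case using assms(2) by simp
next
  case (Cons i js)
  have "((\<lambda>s. x + s *\<^sub>R e i) \<longlongrightarrow> x + 0 *\<^sub>R e i) (nhds 0)"
    by (intro tendsto_intros filterlim_ident)
  then have "\<forall>\<^sub>F s in nhds 0. x + s *\<^sub>R e i \<in> W"
    using topological_tendstoD[OF _ assms(1)] Cons.prems by simp
  then have "\<forall>\<^sub>F s in nhds 0.
      partial_deriv e js g (x + s *\<^sub>R e i) = partial_deriv e js h (x + s *\<^sub>R e i)"
    by (rule eventually_mono) (rule Cons.IH)
  then show ?case
    by (simp add: deriv_cong_ev)
qed

section \<open>Ridge functions in the problem class\<close>

lemma mnorm_bounds: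
  assumes "\<And>vs. length vs = l \<Longrightarrow> (\<forall>v\<in>set vs. norm v \<le> 1) \<Longrightarrow> norm (T vs) \<le> B"
  shows "0 \<le> mnorm l T" "mnorm l T \<le> B"
proof -
  let ?U = "{vs::'a list. length vs = l \<and> (\<forall>v\<in>set vs. norm v \<le> 1)}"
  have mem: "replicate l 0 \<in> ?U" by simp
  have bdd: "bdd_above ((\<lambda>vs. norm (T vs)) ` ?U)"
    by (rule bdd_aboveI[of _ B]) (use assms in auto)
  have "0 \<le> norm (T (replicate l 0))" by simp
  also have "\<dots> \<le> mnorm l T"
    unfolding mnorm_def by (rule cSUP_upper[OF mem bdd])
  finally show "0 \<le> mnorm l T" .
  show "mnorm l T \<le> B"
    unfolding mnorm_def by (rule cSUP_least) (use mem in blast, use assms in blast)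
qed

text \<open>
  The derivatives of a ridge function \<open>v + H(\<kappa> y) u\<close>, with \<open>\<kappa>\<close> a bounded functional, are multiples of
  the product \<open>\<kappa> v\<^sub>1 \<cdots> \<kappa> v\<^sub>l\<close>; the following lemmas show that this product is a bounded multilinear
  form.
\<close>

lemma abs_prod_list_le:
  fixes \<kappa> :: "'a::real_normed_vector \<Rightarrow> real"
  assumes "\<And>v. \<bar>\<kappa> v\<bar> \<le> B * norm v"
  shows "\<bar>prod_list (map \<kappa> vs)\<bar> \<le> B ^ length vs * prod_list (map norm vs)"
proof (induction vs)
  case Nil
  then show ?case by simp
next
  case (Cons v vs)
  have "0 \<le> B * norm v" using assms[of v] by linarith
  then have "\<bar>\<kappa> v\<bar> * \<bar>prod_list (map \<kappa> vs)\<bar>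
      \<le> (B * norm v) * (B ^ length vs * prod_list (map norm vs))"
    by (intro mult_mono assms Cons.IH) auto
  then show ?case by (simp add: abs_mult algebra_simps)
qed

lemma prod_list_norm_le_1:
  assumes "\<forall>v\<in>set vs. norm v \<le> 1"
  shows "prod_list (map norm vs) \<le> 1"
  using assms
proof (induction vs)
  case Nil
  then show ?case by simp
next
  case (Cons v vs)
  have "0 \<le> prod_list (map norm vs)" by (induction vs) auto
  with Cons show ?case by (auto intro!: mult_le_one)
qed

lemma linear_prod_list_update:
  fixes \<kappa> :: "'a::real_normed_vector \<Rightarrow> real"
  assumes "linear \<kappa>" "i < length vs"
  shows "linear (\<lambda>v. prod_list (map \<kappa> (vs[i := v])))"
proof -
  have "prod_list (map \<kappa> (vs[i := v]))
      = \<kappa> v * (prod_list (map \<kappa> (take i vs)) * prod_list (map \<kappa> (drop (Suc i) vs)))" for v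
    using assms(2) by (simp add: upd_conv_take_nth_drop)
  then show ?thesis
    by (intro linearI) (simp_all add: linear_add[OF assms(1)] linear_cmul[OF assms(1)] algebra_simps)
qed

text \<open>
  The \<open>l\<close>-th Frechet derivative of \<open>v + H 0 (\<kappa> y) u\<close> when \<open>H l\<close> is the \<open>l\<close>-th derivative of \<open>H 0\<close>.
\<close>

definition ridge_deriv ::
    "('a::real_normed_vector \<Rightarrow> real) \<Rightarrow> 'a \<Rightarrow> 'a \<Rightarrow> (nat \<Rightarrow> real \<Rightarrow> real) \<Rightarrow> nat \<Rightarrow> 'a \<Rightarrow> 'a list \<Rightarrow> 'a" where
  "ridge_deriv \<kappa> v u H l y vs =
     (if l = 0 then v else 0) + (H l (\<kappa> y) * prod_list (map \<kappa> vs)) *\<^sub>R u"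

text \<open>
  Remainders and increments of the derivatives are scalar ones times the same bounded multilinear
  form, so the one-dimensional chain rule and continuity transfer to the operator norm with a factor
  \<open>B ^ l\<close>.
\<close>

lemma frechet_derivatives_ridge:
  fixes \<kappa> :: "'a::real_normed_vector \<Rightarrow> real"
  assumes bl: "linear \<kappa>" "\<And>y. \<bar>\<kappa> y\<bar> \<le> B * norm y" "0 \<le> B"
    and "norm u = 1"
    and der: "\<And>l x. l < r \<Longrightarrow> (H l has_real_derivative H (Suc l) x) (at x)"
    and cont: "\<And>l. l \<le> r \<Longrightarrow> continuous_on UNIV (H l)"
  shows "frechet_derivatives r K (\<lambda>y. v + H 0 (\<kappa> y) *\<^sub>R u) (ridge_deriv \<kappa> v u H)"
proof -
  have blf: "bounded_linear \<kappa>"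
    using bl by (intro bounded_linear_intro[of _ B])
      (simp_all add: linear_add linear_cmul mult.commute)
  have form: "norm ((\<alpha> * prod_list (map \<kappa> vs)) *\<^sub>R u) \<le> \<bar>\<alpha>\<bar> * B ^ length vs"
    if "\<forall>v\<in>set vs. norm v \<le> 1" for \<alpha> vs
  proof -
    have "\<bar>prod_list (map \<kappa> vs)\<bar> \<le> B ^ length vs * prod_list (map norm vs)"
      by (rule abs_prod_list_le[OF bl(2)])
    also have "\<dots> \<le> B ^ length vs * 1"
      by (intro mult_left_mono prod_list_norm_le_1 that) (simp add: bl(3))
    finally show ?thesis
      by (simp add: abs_mult assms(4) mult_left_mono)
  qed
  have multi: "bounded_multilinear l (ridge_deriv \<kappa> v u H l y)" for l y
  proof -
    have "linear (\<lambda>x. ridge_deriv \<kappa> v u H l y (vs[i := x]))" if "length vs = l" "i < l" for vs i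
    proof -
      have lin: "linear (\<lambda>v. prod_list (map \<kappa> (vs[i := v])))"
        using linear_prod_list_update[OF bl(1)] that by auto
      show ?thesis
        using that unfolding ridge_deriv_def
        by (intro linearI)
           (simp_all add: linear_add[OF lin] linear_cmul[OF lin] algebra_simps)
    qed
    moreover have "norm (ridge_deriv \<kappa> v u H l y vs)
        \<le> (norm v + \<bar>H l (\<kappa> y)\<bar> * B ^ l) * prod_list (map norm vs)" if "length vs = l" for vs
    proof -
      have "\<bar>H l (\<kappa> y)\<bar> * \<bar>prod_list (map \<kappa> vs)\<bar>
          \<le> \<bar>H l (\<kappa> y)\<bar> * (B ^ length vs * prod_list (map norm vs))"
        by (intro mult_left_mono abs_prod_list_le[OF bl(2)]) auto
      moreover have "0 \<le> norm v * prod_list (map norm vs)"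
        by (intro mult_nonneg_nonneg) (auto intro!: prod_list_nonneg)
      ultimately show ?thesis
        using that norm_triangle_ineq[of v "(H l (\<kappa> y) * prod_list (map \<kappa> vs)) *\<^sub>R u"]
        unfolding ridge_deriv_def
        by (auto simp: assms(4) abs_mult algebra_simps)
    qed
    ultimately show ?thesis
      unfolding bounded_multilinear_def by blast
  qed
  have quot: "((\<lambda>x. mnorm l (\<lambda>vs. ridge_deriv \<kappa> v u H l x vs - ridge_deriv \<kappa> v u H l y vs
        - ridge_deriv \<kappa> v u H (Suc l) y ((x - y) # vs)) / norm (x - y)) \<longlongrightarrow> 0) (at y within K)"
    if l: "l < r" for l y
  proof -
    define \<rho> where "\<rho> x = H l (\<kappa> x) - H l (\<kappa> y) - H (Suc l) (\<kappa> y) * \<kappa> (x - y)" for x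
    have "((\<lambda>x. H l (\<kappa> x)) has_derivative (\<lambda>x. H (Suc l) (\<kappa> y) * \<kappa> x)) (at y)"
      by (rule has_derivative_compose[OF bounded_linear.has_derivative[OF blf has_derivative_ident]
            der[OF l, unfolded has_field_derivative_def]])
    then have "((\<lambda>x. H l (\<kappa> x)) has_derivative (\<lambda>x. H (Suc l) (\<kappa> y) * \<kappa> x)) (at y within K)"
      by (rule has_derivative_at_withinI)
    then have "((\<lambda>x. norm (\<rho> x) / norm (x - y)) \<longlongrightarrow> 0) (at y within K)"
      unfolding has_derivative_iff_norm \<rho>_def by simp
    then have lim: "((\<lambda>x. B ^ l * (norm (\<rho> x) / norm (x - y))) \<longlongrightarrow> 0) (at y within K)"
      by (rule tendsto_mult_right_zero)
    have eq: "(\<lambda>vs. ridge_deriv \<kappa> v u H l x vs - ridge_deriv \<kappa> v u H l y vs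
        - ridge_deriv \<kappa> v u H (Suc l) y ((x - y) # vs))
        = (\<lambda>vs. (\<rho> x * prod_list (map \<kappa> vs)) *\<^sub>R u)" for x
      unfolding ridge_deriv_def \<rho>_def by (auto simp: algebra_simps)
    have bd: "0 \<le> mnorm l (\<lambda>vs. (\<rho> x * prod_list (map \<kappa> vs)) *\<^sub>R u)"
        "mnorm l (\<lambda>vs. (\<rho> x * prod_list (map \<kappa> vs)) *\<^sub>R u) \<le> B ^ l * norm (\<rho> x)" for x
      using mnorm_bounds[of l "\<lambda>vs. (\<rho> x * prod_list (map \<kappa> vs)) *\<^sub>R u" "B ^ l * norm (\<rho> x)"]
        form[of _ "\<rho> x"]
      by (auto simp: mult.commute)
    have "mnorm l (\<lambda>vs. (\<rho> x * prod_list (map \<kappa> vs)) *\<^sub>R u) / norm (x - y)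
        \<le> B ^ l * (norm (\<rho> x) / norm (x - y))" for x
      using divide_right_mono[OF bd(2)[of x], of "norm (x - y)"] by simp
    then show ?thesis
      unfolding eq
      by (intro tendsto_sandwich[OF _ _ tendsto_const lim] always_eventually allI)
         (simp_all add: bd(1))
  qed
  have cont': "((\<lambda>x. mnorm l (\<lambda>vs. ridge_deriv \<kappa> v u H l x vs - ridge_deriv \<kappa> v u H l y vs)) \<longlongrightarrow> 0)
      (at y within K)" if l: "l \<le> r" for l y
  proof -
    define \<rho> where "\<rho> x = H l (\<kappa> x) - H l (\<kappa> y)" for x
    have "isCont (H l) (\<kappa> y)"
      using cont[OF l] by (simp add: continuous_on_eq_continuous_at)
    moreover have "(\<kappa> \<longlongrightarrow> \<kappa> y) (at y within K)"
      by (rule bounded_linear.tendsto[OF blf tendsto_ident_at])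
    ultimately have "((\<lambda>x. H l (\<kappa> x)) \<longlongrightarrow> H l (\<kappa> y)) (at y within K)"
      by (rule isCont_tendsto_compose)
    then have "((\<lambda>x. norm (\<rho> x)) \<longlongrightarrow> 0) (at y within K)"
      unfolding \<rho>_def by (intro tendsto_norm_zero) (simp add: LIM_zero)
    then have lim: "((\<lambda>x. B ^ l * norm (\<rho> x)) \<longlongrightarrow> 0) (at y within K)"
      by (rule tendsto_mult_right_zero)
    have eq: "(\<lambda>vs. ridge_deriv \<kappa> v u H l x vs - ridge_deriv \<kappa> v u H l y vs)
        = (\<lambda>vs. (\<rho> x * prod_list (map \<kappa> vs)) *\<^sub>R u)" for x
      unfolding ridge_deriv_def \<rho>_def by (auto simp: algebra_simps)
    have bd: "0 \<le> mnorm l (\<lambda>vs. (\<rho> x * prod_list (map \<kappa> vs)) *\<^sub>R u)"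
        "mnorm l (\<lambda>vs. (\<rho> x * prod_list (map \<kappa> vs)) *\<^sub>R u) \<le> B ^ l * norm (\<rho> x)" for x
      using mnorm_bounds[of l "\<lambda>vs. (\<rho> x * prod_list (map \<kappa> vs)) *\<^sub>R u" "B ^ l * norm (\<rho> x)"]
        form[of _ "\<rho> x"]
      by (auto simp: mult.commute)
    show ?thesis
      unfolding eq
      by (rule tendsto_sandwich[OF _ _ tendsto_const lim]) (use bd in auto)
  qed
  show ?thesis
    unfolding frechet_derivatives_def
    using multi quot cont' by (auto simp: ridge_deriv_def)
qed

lemma mnorm_ridge_deriv_le:
  fixes \<kappa> :: "'a::real_normed_vector \<Rightarrow> real"
  assumes "\<And>y. \<bar>\<kappa> y\<bar> \<le> B * norm y" "0 \<le> B" "norm u = 1" "1 \<le> l"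
  shows "mnorm l (ridge_deriv \<kappa> v u H l y) \<le> \<bar>H l (\<kappa> y)\<bar> * B ^ l"
proof (rule mnorm_bounds(2))
  fix vs :: "'a list"
  assume vs: "length vs = l" "\<forall>v\<in>set vs. norm v \<le> 1"
  have "\<bar>prod_list (map \<kappa> vs)\<bar> \<le> B ^ length vs * prod_list (map norm vs)"
    by (rule abs_prod_list_le[OF assms(1)])
  also have "\<dots> \<le> B ^ length vs * 1"
    by (intro mult_left_mono prod_list_norm_le_1 vs) (simp add: assms(2))
  finally show "norm (ridge_deriv \<kappa> v u H l y vs) \<le> \<bar>H l (\<kappa> y)\<bar> * B ^ l"
    using assms(3,4) vs(1) by (simp add: ridge_deriv_def abs_mult mult_left_mono)
qed

text \<open>
  Every problem in the proof has a right-hand side of this form, with \<open>H = 0\<close> for the constant ones.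
  Since the coordinate is a functional of norm at most \<open>B\<close>, bounds on \<open>H l\<close> are needed with the
  factor \<open>B ^ l\<close>.
\<close>

lemma ridge_in_problem_class:
  fixes e :: "nat \<Rightarrow> 'a::banach"
  assumes sb: "schauder_basis e" and "norm (e 1) = 1"
    and B: "\<And>y. \<bar>coord e y 0\<bar> \<le> B * norm y" "0 \<le> B"
    and der: "\<And>l x. l < r \<Longrightarrow> (H l has_real_derivative H (Suc l) x) (at x)"
    and cont: "\<And>l. l \<le> r \<Longrightarrow> continuous_on UNIV (H l)"
    and bound: "\<And>l x. l \<in> {1..r} \<Longrightarrow> \<bar>H l x\<bar> * B ^ l \<le> D"
    and lip: "\<And>x y. \<bar>H 0 x - H 0 y\<bar> * B \<le> L * \<bar>x - y\<bar>"
    and "0 \<le> L"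
    and init: "\<And>k. 1 \<le> k \<Longrightarrow> norm (\<eta> - proj e k \<eta>) \<le> \<gamma> k"
    and start: "\<And>x. norm (v + H 0 x *\<^sub>R e 1) \<le> M"
    and tail: "\<And>k x. 1 \<le> k \<Longrightarrow>
        norm (v + H 0 x *\<^sub>R e 1 - proj e k (v + H 0 x *\<^sub>R e 1)) \<le> \<delta> k"
  shows "(\<lambda>y. v + H 0 (coord e y 0) *\<^sub>R e 1, \<eta>) \<in> problem_class e r L M D \<gamma> \<delta> R"
proof -
  have lin: "linear (\<lambda>y. coord e y 0)" by (rule linear_coord[OF sb])
  have lipf: "\<bar>H 0 (coord e x 0) - H 0 (coord e y 0)\<bar> \<le> L * norm (x - y)" for x y
  proof (cases "B = 0")
    (* The factor B cannot be cancelled from lip, but the coordinate vanishes identically. *)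
    case True
    then have "coord e x 0 = 0" "coord e y 0 = 0" using B(1)[of x] B(1)[of y] by auto
    then show ?thesis using \<open>0 \<le> L\<close> by simp
  next
    case False
    then have "0 < B" using B(2) by simp
    have "\<bar>H 0 (coord e x 0) - H 0 (coord e y 0)\<bar> * B \<le> L * \<bar>coord e (x - y) 0\<bar>"
      using lip linear_diff[OF lin] by metis
    also have "\<dots> \<le> L * (B * norm (x - y))"
      by (intro mult_left_mono B \<open>0 \<le> L\<close>)
    finally have "\<bar>H 0 (coord e x 0) - H 0 (coord e y 0)\<bar> * B \<le> (L * norm (x - y)) * B"
      by (simp add: algebra_simps)
    then show ?thesis using \<open>0 < B\<close> by simp
  qed
  have "norm ((v + H 0 (coord e x 0) *\<^sub>R e 1) - (v + H 0 (coord e y 0) *\<^sub>R e 1)) \<le> L * norm (x - y)" for x y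
    using lipf[of x y] assms(2) by (simp flip: scaleR_diff_left)
  then have "basic_conditions e L M \<gamma> (\<lambda>y. v + H 0 (coord e y 0) *\<^sub>R e 1) \<eta>"
    unfolding basic_conditions_def using init start by blast
  moreover have "frechet_derivatives r (cball \<eta> R) (\<lambda>y. v + H 0 (coord e y 0) *\<^sub>R e 1)
      (ridge_deriv (\<lambda>y. coord e y 0) v (e 1) H)"
    by (rule frechet_derivatives_ridge[OF lin B assms(2)]) (fact der cont)+
  moreover have "mnorm l (ridge_deriv (\<lambda>y. coord e y 0) v (e 1) H l y) \<le> D" if "l \<in> {1..r}" for l y
    using mnorm_ridge_deriv_le[OF B assms(2), of l v H y] bound[OF that, of "coord e y 0"] that by simp
  ultimately show ?thesis
    unfolding problem_class_def using tail by blast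
qed

lemma constant_in_problem_class:
  fixes e :: "nat \<Rightarrow> 'a::banach"
  assumes "schauder_basis e" "norm (e 1) = 1"
    and "\<And>y. \<bar>coord e y 0\<bar> \<le> B * norm y" "0 \<le> B"
    and "0 \<le> L" "0 \<le> D"
    and "\<And>k. 1 \<le> k \<Longrightarrow> norm (\<eta> - proj e k \<eta>) \<le> \<gamma> k"
    and "norm v \<le> M"
    and "\<And>k. 1 \<le> k \<Longrightarrow> norm (v - proj e k v) \<le> \<delta> k"
  shows "(\<lambda>y. v, \<eta>) \<in> problem_class e r L M D \<gamma> \<delta> R"
  using ridge_in_problem_class[of e B r "\<lambda>_ _. 0" D L \<eta> \<gamma> v M \<delta> R] assms by simp

lemma ivp_sol_constant: "ivp_sol (\<lambda>y. v) a b \<eta> (\<lambda>s. \<eta> + (s - a) *\<^sub>R v)"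
  unfolding ivp_sol_def by (auto intro!: derivative_eq_intros)

section \<open>Truncation bounds\<close>

text \<open>
  An initial value along \<open>e N\<close> is projected to 0 by the first \<open>N\<close> coordinates, whatever its sign, and
  monotonicity of \<open>\<gamma>\<close> turns the single bound \<open>\<gamma> N\<close> into all bounds with smaller index.
\<close>

lemma worst_case_error_ge_initial_tail:
  fixes e :: "nat \<Rightarrow> 'a::banach"
  assumes sb: "schauder_basis e" and nrm: "\<And>j. norm (e j) = 1"
    and B: "\<And>y. \<bar>coord e y 0\<bar> \<le> B * norm y" "0 \<le> B"
    and "a < b" "0 \<le> L" "0 \<le> M" "0 \<le> D"
    and "positive_seq \<gamma>" "\<And>i k. 1 \<le> i \<Longrightarrow> i \<le> k \<Longrightarrow> \<gamma> k \<le> \<gamma> i"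
    and "positive_seq \<delta>" "1 \<le> N"
  shows "ereal (\<gamma> N) \<le> worst_case_error e a b n t N (problem_class e r L M D \<gamma> \<delta> R) S \<phi>"
proof -
  have pos: "0 < \<gamma> k" "0 < \<delta> k" if "1 \<le> k" for k
    using assms that unfolding positive_seq_def by auto
  define \<eta> where "\<eta> \<sigma> = (\<sigma> * \<gamma> N) *\<^sub>R e N" for \<sigma> :: real
  have pr: "proj e k (\<eta> \<sigma>) = (if N < k then \<eta> \<sigma> else 0)" for k \<sigma>
    unfolding \<eta>_def by (rule proj_basis[OF sb])
  have in_class: "(\<lambda>y. 0, \<eta> \<sigma>) \<in> problem_class e r L M D \<gamma> \<delta> R" if "\<bar>\<sigma>\<bar> = 1" for \<sigma>
  proof (rule constant_in_problem_class[OF sb nrm B \<open>0 \<le> L\<close> \<open>0 \<le> D\<close>])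
    fix k :: nat assume "1 \<le> k"
    moreover have "norm (\<eta> \<sigma>) = \<gamma> N"
      using that pos(1)[OF \<open>1 \<le> N\<close>] by (simp add: \<eta>_def nrm abs_mult)
    ultimately show "norm (\<eta> \<sigma> - proj e k (\<eta> \<sigma>)) \<le> \<gamma> k"
      unfolding pr using assms(10)[of k N] pos(1)[of k] by auto
    show "norm (0 - proj e k 0) \<le> \<delta> k"
      using \<open>1 \<le> k\<close> pos(2)[of k] linear_0[OF linear_proj[OF sb]] by simp
  qed (use assms in simp)
  have "ereal (norm ((\<eta> 1 + (a - a) *\<^sub>R 0) - (\<eta> (-1) + (a - a) *\<^sub>R 0)) / 2)
      \<le> worst_case_error e a b n t N (problem_class e r L M D \<gamma> \<delta> R) S \<phi>"
    by (rule worst_case_error_ge_half_distance[OF in_class in_class _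
          ivp_sol_constant ivp_sol_constant])
       (use \<open>a < b\<close> in \<open>auto simp: pr intro!: information_cong\<close>)
  moreover have "norm ((\<eta> 1 + (a - a) *\<^sub>R 0) - (\<eta> (-1) + (a - a) *\<^sub>R 0)) / 2 = \<gamma> N"
  proof -
    have "(\<eta> 1 + (a - a) *\<^sub>R 0) - (\<eta> (-1) + (a - a) *\<^sub>R 0) = (2 * \<gamma> N) *\<^sub>R e N"
      unfolding \<eta>_def by (simp flip: scaleR_add_left)
    then show ?thesis using pos(1)[OF \<open>1 \<le> N\<close>] by (simp add: nrm)
  qed
  ultimately show ?thesis by simp
qed

text \<open>
  A constant right-hand side along \<open>e N\<close> has vanishing components \<open>j < N\<close>, the only ones that may be
  evaluated.  The factor \<open>min 1 (M / \<delta> 1)\<close> keeps its norm below both \<open>\<delta> N\<close> and \<open>M\<close>.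
\<close>

lemma worst_case_error_ge_rhs_tail:
  fixes e :: "nat \<Rightarrow> 'a::banach"
  assumes sb: "schauder_basis e" and nrm: "\<And>j. norm (e j) = 1"
    and B: "\<And>y. \<bar>coord e y 0\<bar> \<le> B * norm y" "0 \<le> B"
    and "a < b" "0 \<le> L" "0 \<le> M" "0 \<le> D"
    and "positive_seq \<gamma>" "positive_seq \<delta>" "\<And>i k. 1 \<le> i \<Longrightarrow> i \<le> k \<Longrightarrow> \<delta> k \<le> \<delta> i"
    and "1 \<le> N"
    and adm: "admissible_information e r N m (problem_class e r L M D \<gamma> \<delta> R) S"
  shows "ereal ((b - a) * min 1 (M / \<delta> 1) * \<delta> N)
      \<le> worst_case_error e a b n t N (problem_class e r L M D \<gamma> \<delta> R) S \<phi>"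
proof -
  have pos: "0 < \<gamma> k" "0 < \<delta> k" if "1 \<le> k" for k
    using assms that unfolding positive_seq_def by auto
  define c where "c = min 1 (M / \<delta> 1) * \<delta> N"
  have c0: "0 \<le> c"
    unfolding c_def using pos(2)[of 1] pos(2)[OF \<open>1 \<le> N\<close>] \<open>0 \<le> M\<close> by simp
  have c1: "c \<le> \<delta> N"
    unfolding c_def using pos(2)[OF \<open>1 \<le> N\<close>] by (simp add: mult_left_le_one_le min_def)
  have c2: "c \<le> M"
  proof -
    have "c \<le> M / \<delta> 1 * \<delta> 1"
      unfolding c_def using pos(2)[OF \<open>1 \<le> N\<close>] pos(2)[of 1] assms(11)[of 1 N] \<open>1 \<le> N\<close> \<open>0 \<le> M\<close>
      by (intro mult_mono) auto
    then show ?thesis using pos(2)[of 1] by simp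
  qed
  define v where "v \<sigma> = (\<sigma> * c) *\<^sub>R e N" for \<sigma> :: real
  have pr: "proj e k (v \<sigma>) = (if N < k then v \<sigma> else 0)" for k \<sigma>
    unfolding v_def by (rule proj_basis[OF sb])
  have nv: "norm (v \<sigma>) = c" if "\<bar>\<sigma>\<bar> = 1" for \<sigma>
    using that c0 by (simp add: v_def nrm abs_mult)
  have in_class: "(\<lambda>y. v \<sigma>, 0) \<in> problem_class e r L M D \<gamma> \<delta> R" if "\<bar>\<sigma>\<bar> = 1" for \<sigma>
  proof (rule constant_in_problem_class[OF sb nrm B \<open>0 \<le> L\<close> \<open>0 \<le> D\<close>])
    fix k :: nat assume "1 \<le> k"
    then show "norm (v \<sigma> - proj e k (v \<sigma>)) \<le> \<delta> k"
      unfolding pr using assms(11)[of k N] pos(2)[of k] nv[OF that] c1 by auto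
    show "norm (0 - proj e k 0) \<le> \<gamma> k"
      using \<open>1 \<le> k\<close> pos(1)[of k] linear_0[OF linear_proj[OF sb]] by simp
  qed (use nv[OF that] c2 in simp)
  have info: "information e N S (\<lambda>y. v 1) 0 = information e N S (\<lambda>y. v (-1)) 0"
  proof (rule information_cong)
    fix q assume q: "q \<in> set (strategy_queries e N (\<lambda>y. v 1) (S (proj e N 0)))"
    obtain y j js where [simp]: "q = (y, j, js)" by (cases q) auto
    have "j < N"
      using adm in_class[of 1] q unfolding admissible_information_def Let_def by fastforce
    then have "(\<lambda>x::'a. coord e (v 1) j) = (\<lambda>x. coord e (v (-1)) j)"
      by (simp only: v_def coord_scaleR[OF sb] coord_basis[OF sb]) simp
    then show "eval_result e N (\<lambda>y. v 1) q = eval_result e N (\<lambda>y. v (-1)) q"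
      by simp
  qed simp
  have "ereal (norm ((0 + (b - a) *\<^sub>R v 1) - (0 + (b - a) *\<^sub>R v (-1))) / 2)
      \<le> worst_case_error e a b n t N (problem_class e r L M D \<gamma> \<delta> R) S \<phi>"
    by (rule worst_case_error_ge_half_distance[OF in_class in_class info
          ivp_sol_constant ivp_sol_constant])
       (use \<open>a < b\<close> in auto)
  moreover have "(0 + (b - a) *\<^sub>R v 1) - (0 + (b - a) *\<^sub>R v (-1)) = (2 * ((b - a) * c)) *\<^sub>R e N"
    unfolding v_def by (simp add: algebra_simps flip: scaleR_add_left)
  ultimately show ?thesis
    using c0 \<open>a < b\<close> by (simp add: nrm c_def mult.assoc)
qed

section \<open>Compactly supported bumps\<close>

text \<open>
  Powers of the positive part supply functions of prescribed finite smoothness that vanish on a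
  half-line; their product with a reflected copy has support in the unit interval.
\<close>

lemma has_real_derivative_positive_part_power:
  assumes "2 \<le> k"
  shows "((\<lambda>x. max 0 x ^ k) has_real_derivative real k * max 0 x ^ (k - 1)) (at x)"
proof -
  consider "0 < x" | "x < 0" | "x = 0" by linarith
  then show ?thesis
  proof cases
    case 1
    have "((\<lambda>x. x ^ k) has_real_derivative real k * max 0 x ^ (k - 1)) (at x)"
      using 1 by (auto intro!: derivative_eq_intros)
    then show ?thesis
      by (rule has_field_derivative_transform_within_open[of _ _ _ "{0<..}"]) (use 1 in auto)
  next
    case 2
    have "((\<lambda>x. 0) has_real_derivative real k * max 0 x ^ (k - 1)) (at x)"
      using 2 assms by (simp add: power_0_left)
    then show ?thesis
      by (rule has_field_derivative_transform_within_open[of _ _ _ "{..<0}"])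
         (use 2 assms in auto)
  next
    case 3
    obtain j where k: "k = Suc (Suc j)"
      using le_Suc_ex[OF assms] by auto
    have "((\<lambda>h. max 0 h ^ Suc j) \<longlongrightarrow> max 0 0 ^ Suc j) (at (0::real))"
      by (intro tendsto_intros)
    moreover have "\<forall>\<^sub>F h in at (0::real). max 0 h ^ Suc j = (max 0 (0 + h) ^ k - max 0 0 ^ k) / h"
      unfolding eventually_at_filter k by (auto simp: max_def)
    ultimately have "((\<lambda>h. (max 0 (0 + h) ^ k - max 0 0 ^ k) / h) \<longlongrightarrow> max 0 0 ^ Suc j) (at (0::real))"
      by (rule Lim_transform_eventually)
    then show ?thesis
      unfolding DERIV_def 3 using k by simp
  qed
qed

text \<open>
  The \<open>l\<close>-th derivative of \<open>max 0 x ^ i * max 0 (1 - x) ^ j\<close>, arranged by the product rule into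
  derivatives of functions of the same kind with lower exponents.  This makes differentiability,
  support and bounds simple inductions on \<open>l\<close>, as long as the exponents exceed \<open>l\<close>.
\<close>

primrec bump_deriv :: "nat \<Rightarrow> nat \<Rightarrow> nat \<Rightarrow> real \<Rightarrow> real" where
  "bump_deriv 0 i j = (\<lambda>x. max 0 x ^ i * max 0 (1 - x) ^ j)"
| "bump_deriv (Suc l) i j =
     (\<lambda>x. real i * bump_deriv l (i - 1) j x - real j * bump_deriv l i (j - 1) x)"

lemma has_real_derivative_bump_deriv:
  assumes "l + 2 \<le> i" "l + 2 \<le> j"
  shows "(bump_deriv l i j has_real_derivative bump_deriv (Suc l) i j x) (at x)"
  using assms
proof (induction l arbitrary: i j)
  case 0
  have right: "((\<lambda>x. max 0 (1 - x) ^ j) has_real_derivative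
      (real j * max 0 (1 - x) ^ (j - 1)) * (-1)) (at x)"
    by (rule DERIV_chain2[OF has_real_derivative_positive_part_power])
       (use 0 in \<open>auto intro!: derivative_eq_intros\<close>)
  have left: "((\<lambda>x. max 0 x ^ i) has_real_derivative real i * max 0 x ^ (i - 1)) (at x)"
    by (rule has_real_derivative_positive_part_power) (use 0 in simp)
  have "(bump_deriv 0 i j has_real_derivative
      real i * max 0 x ^ (i - 1) * max 0 (1 - x) ^ j
      + real j * max 0 (1 - x) ^ (j - 1) * (-1) * max 0 x ^ i) (at x)"
    unfolding bump_deriv.simps by (rule DERIV_mult[OF left right])
  then show ?case
    by (rule DERIV_cong) (simp add: algebra_simps)
next
  case (Suc l)
  have "(bump_deriv l (i - 1) j has_real_derivative bump_deriv (Suc l) (i - 1) j x) (at x)"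
    "(bump_deriv l i (j - 1) has_real_derivative bump_deriv (Suc l) i (j - 1) x) (at x)"
    by (rule Suc.IH; use Suc.prems in simp)+
  then show ?case
    unfolding bump_deriv.simps(2)[of "Suc l" i j] bump_deriv.simps(2)[of l i j]
    by (intro DERIV_diff DERIV_cmult)
qed

lemma continuous_on_bump_deriv: "continuous_on S (bump_deriv l i j)"
  by (induction l arbitrary: i j) (auto intro!: continuous_intros)

lemma bump_deriv_eq_0:
  assumes "l < i" "l < j" "x \<notin> {0<..<1}"
  shows "bump_deriv l i j x = 0"
  using assms by (induction l arbitrary: i j) (auto simp: max_def)

lemma bump_deriv_nonneg: "0 \<le> bump_deriv 0 i j x"
  by simp

lemma abs_bump_deriv_le:
  assumes "l < i" "l < j"
  shows "\<bar>bump_deriv l i j x\<bar> \<le> real (i + j) ^ l"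
  using assms
proof (induction l arbitrary: i j)
  case 0
  have "max 0 x ^ i * max 0 (1 - x) ^ j \<le> 1"
  proof (cases "x \<in> {0<..<1}")
    case True
    then show ?thesis by (intro mult_le_one power_le_one) auto
  next
    case False
    then have "max 0 x ^ i * max 0 (1 - x) ^ j = 0"
      using bump_deriv_eq_0[of 0 i j x] 0 unfolding bump_deriv.simps by blast
    then show ?thesis by linarith
  qed
  then show ?case by simp
next
  case (Suc l)
  have mono: "real (i - 1 + j) ^ l \<le> real (i + j) ^ l" "real (i + (j - 1)) ^ l \<le> real (i + j) ^ l"
    by (intro power_mono; simp)+
  have "\<bar>bump_deriv (Suc l) i j x\<bar>
      \<le> real i * \<bar>bump_deriv l (i - 1) j x\<bar> + real j * \<bar>bump_deriv l i (j - 1) x\<bar>"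
    using abs_triangle_ineq4[of "real i * bump_deriv l (i - 1) j x" "real j * bump_deriv l i (j - 1) x"]
    by (simp add: abs_mult)
  also have "\<dots> \<le> real i * real (i + j) ^ l + real j * real (i + j) ^ l"
    using order_trans[OF Suc.IH[of "i - 1" j] mono(1)] order_trans[OF Suc.IH[of i "j - 1"] mono(2)]
      Suc.prems
    by (intro add_mono mult_left_mono) auto
  also have "\<dots> = real (i + j) ^ Suc l"
    by (simp add: algebra_simps)
  finally show ?case .
qed

lemma bump_deriv_ge:
  assumes "x \<in> {1/4..3/4}"
  shows "(1/16) ^ k \<le> bump_deriv 0 k k x"
proof -
  have "(1/4) ^ k * (1/4) ^ k \<le> max 0 x ^ k * max 0 (1 - x) ^ k"
    using assms by (intro mult_mono power_mono) auto
  then show ?thesis by (simp flip: power_mult_distrib)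
qed

section \<open>Combs of bumps\<close>

text \<open>
  For \<open>l \<le> q\<close> and \<open>w > 0\<close> this is the \<open>l\<close>-th derivative of a sum of bumps of height proportional to
  \<open>\<epsilon> * w ^ q\<close>, one over each of the cells \<open>[2iw, (2i+1)w]\<close> with \<open>i \<in> A\<close>.  The gaps of length \<open>w\<close> keep
  the closed cells disjoint, so that one point spoils at most one cell.
\<close>

definition comb :: "real \<Rightarrow> real \<Rightarrow> nat \<Rightarrow> nat set \<Rightarrow> nat \<Rightarrow> real \<Rightarrow> real" where
  "comb \<epsilon> w q A l x =
     \<epsilon> * w ^ (q - l) * (\<Sum>i\<in>A. bump_deriv l (Suc q) (Suc q) (x / w - 2 * real i))"

lemma has_real_derivative_comb:
  assumes "0 < w" "l < q"
  shows "(comb \<epsilon> w q A l has_real_derivative comb \<epsilon> w q A (Suc l) x) (at x)"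
proof -
  let ?b = "\<lambda>l. bump_deriv l (Suc q) (Suc q)"
  have "((\<lambda>x. ?b l (x / w - 2 * real i)) has_real_derivative
      ?b (Suc l) (x / w - 2 * real i) * (1 / w)) (at x)" for i
    by (rule DERIV_chain2[OF has_real_derivative_bump_deriv])
       (use assms in \<open>auto intro!: derivative_eq_intros\<close>)
  then have "((\<lambda>x. \<epsilon> * w ^ (q - l) * (\<Sum>i\<in>A. ?b l (x / w - 2 * real i))) has_real_derivative
      \<epsilon> * w ^ (q - l) * (\<Sum>i\<in>A. ?b (Suc l) (x / w - 2 * real i) * (1 / w))) (at x)"
    by (intro DERIV_cmult DERIV_sum)
  moreover have "w ^ (q - l) = w ^ (q - Suc l) * w"
    using \<open>l < q\<close> by (metis Suc_diff_Suc power_Suc2)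
  then have "\<epsilon> * w ^ (q - l) * (\<Sum>i\<in>A. ?b (Suc l) (x / w - 2 * real i) * (1 / w))
      = comb \<epsilon> w q A (Suc l) x"
    using \<open>0 < w\<close> by (simp add: comb_def flip: sum_divide_distrib)
  moreover have "comb \<epsilon> w q A l = (\<lambda>x. \<epsilon> * w ^ (q - l) * (\<Sum>i\<in>A. ?b l (x / w - 2 * real i)))"
    by (simp add: comb_def fun_eq_iff)
  ultimately show ?thesis by simp
qed

lemma continuous_on_comb:
  assumes "w \<noteq> 0"
  shows "continuous_on S (comb \<epsilon> w q A l)"
  unfolding comb_def
  by (intro continuous_intros continuous_on_compose2[OF continuous_on_bump_deriv[of UNIV]])
     (use assms in auto)

lemma comb_eq_0:
  assumes "\<And>i. i \<in> A \<Longrightarrow> x / w - 2 * real i \<notin> {0<..<1}"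
  shows "comb \<epsilon> w q A 0 x = 0"
proof -
  have "(\<Sum>i\<in>A. bump_deriv 0 (Suc q) (Suc q) (x / w - 2 * real i)) = 0"
    by (intro sum.neutral ballI bump_deriv_eq_0) (use assms in auto)
  then show ?thesis by (simp add: comb_def)
qed

text \<open>
  At most one bump is nonzero at any point, so the bound does not grow with the number of bumps.
\<close>

lemma abs_comb_le:
  assumes "finite A" "0 \<le> \<epsilon>" "0 \<le> w" "w \<le> 1" "l \<le> q"
  shows "\<bar>comb \<epsilon> w q A l x\<bar> \<le> \<epsilon> * real (2 * Suc q) ^ l"
proof -
  let ?g = "\<lambda>i. bump_deriv l (Suc q) (Suc q) (x / w - 2 * real i)"
  have off: "?g i = 0" if "x / w - 2 * real i \<notin> {0<..<1}" for i
    using that assms(5) by (intro bump_deriv_eq_0) auto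
  have "\<bar>\<Sum>i\<in>A. ?g i\<bar> \<le> real (2 * Suc q) ^ l"
  proof (cases "\<exists>i\<in>A. x / w - 2 * real i \<in> {0<..<1}")
    case True
    then obtain i where i: "i \<in> A" "x / w - 2 * real i \<in> {0<..<1}" by blast
    have "?g j = 0" if "j \<in> A - {i}" for j
    proof (rule off)
      have "real j + 1 \<le> real i \<or> real i + 1 \<le> real j"
        using that by (cases i j rule: linorder_cases) auto
      then show "x / w - 2 * real j \<notin> {0<..<1}"
        using i(2) by auto
    qed
    then have "(\<Sum>i\<in>A. ?g i) = ?g i"
      using sum.remove[OF assms(1) i(1), of ?g] by simp
    moreover have "\<bar>?g i\<bar> \<le> real (Suc q + Suc q) ^ l"
      by (rule abs_bump_deriv_le) (use assms(5) in auto)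
    ultimately show ?thesis by (simp only: mult_2)
  next
    case False
    then have "(\<Sum>i\<in>A. ?g i) = 0" by (intro sum.neutral) (use off in blast)
    then show ?thesis by simp
  qed
  moreover have "w ^ (q - l) \<le> 1"
    using assms by (intro power_le_one)
  ultimately have "w ^ (q - l) * \<bar>\<Sum>i\<in>A. ?g i\<bar> \<le> 1 * real (2 * Suc q) ^ l"
    by (intro mult_mono) auto
  then have "\<epsilon> * (w ^ (q - l) * \<bar>\<Sum>i\<in>A. ?g i\<bar>) \<le> \<epsilon> * real (2 * Suc q) ^ l"
    using assms(2) by (intro mult_left_mono) auto
  then show ?thesis
    using assms unfolding comb_def by (simp add: abs_mult mult.assoc)
qed

text \<open>
  With a clock of speed \<open>c\<close>, a cell of width \<open>c * h\<close> is crossed in time \<open>h\<close>.  Each bump is at least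
  \<open>(1/16) ^ Suc q\<close>, up to scaling, on the middle half of its cell.
\<close>

lemma integral_comb_ge:
  assumes "0 < h" "0 < c" "0 \<le> \<epsilon>" "finite A" "A \<subseteq> {..<p}" "a + 2 * real p * h \<le> b"
  shows "\<epsilon> * (c * h) ^ q * (real (card A) * ((1/16) ^ Suc q * (h / 2)))
    \<le> integral {a..b} (\<lambda>s. comb \<epsilon> (c * h) q A 0 (c * (s - a)))"
proof -
  let ?g = "\<lambda>i s. bump_deriv 0 (Suc q) (Suc q) ((s - a) / h - 2 * real i)"
  have cont: "continuous_on S (?g i)" for i S
    by (intro continuous_intros continuous_on_compose2[OF continuous_on_bump_deriv[of UNIV]])
       (use assms in auto)
  have int: "?g i integrable_on {u..v}" for i u v
    by (rule integrable_continuous_interval[OF cont])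
  have one: "(1/16) ^ Suc q * (h / 2) \<le> integral {a..b} (?g i)" if "i \<in> A" for i
  proof -
    let ?u = "a + (2 * real i + 1/4) * h" and ?v = "a + (2 * real i + 3/4) * h"
    have "real i + 1 \<le> real p" using that assms(5) by auto
    then have "(2 * real i + 3/4) * h \<le> 2 * real p * h"
      using \<open>0 < h\<close> by (intro mult_right_mono) auto
    moreover have "0 \<le> (2 * real i + 1/4) * h"
      using \<open>0 < h\<close> by simp
    ultimately have sub: "{?u..?v} \<subseteq> {a..b}"
      unfolding atLeastatMost_subset_iff using assms(6) by (intro disjI2 conjI) linarith+
    have mid: "(s - a) / h - 2 * real i \<in> {1/4..3/4}" if "s \<in> {?u..?v}" for s
      using that \<open>0 < h\<close> by (auto simp: field_simps)
    have "integral {?u..?v} (\<lambda>s. (1/16) ^ Suc q) \<le> integral {?u..?v} (?g i)"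
      by (intro integral_le int) (use bump_deriv_ge mid in \<open>auto simp del: power_Suc bump_deriv.simps\<close>)
    moreover have "?v - ?u = h / 2" by (simp add: algebra_simps)
    then have "integral {?u..?v} (\<lambda>s. (1/16) ^ Suc q) = (1/16) ^ Suc q * (h / 2)"
      using \<open>0 < h\<close> by (simp add: integral_const_real algebra_simps)
    moreover have "integral {?u..?v} (?g i) \<le> integral {a..b} (?g i)"
      by (rule integral_subset_le[OF sub int int]) (simp add: bump_deriv_nonneg)
    ultimately show ?thesis by linarith
  qed
  have "(\<lambda>s. comb \<epsilon> (c * h) q A 0 (c * (s - a))) = (\<lambda>s. \<epsilon> * (c * h) ^ q * (\<Sum>i\<in>A. ?g i s))"
    using \<open>0 < c\<close> by (simp add: comb_def)
  then have eq: "integral {a..b} (\<lambda>s. comb \<epsilon> (c * h) q A 0 (c * (s - a)))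
      = \<epsilon> * (c * h) ^ q * (\<Sum>i\<in>A. integral {a..b} (?g i))"
    using integral_sum[OF assms(4) int, of a b] by (simp del: bump_deriv.simps)
  have "real (card A) * ((1/16) ^ Suc q * (h / 2)) \<le> (\<Sum>i\<in>A. integral {a..b} (?g i))"
    by (rule sum_bounded_below) (rule one)
  then show ?thesis
    unfolding eq using assms(1-3) by (intro mult_left_mono) auto
qed

text \<open>
  A point in cell \<open>i\<close> determines \<open>i\<close> by rounding down, so \<open>m\<close> points hit at most \<open>m\<close> of the \<open>2m\<close> cells.
\<close>

lemma card_free_cells_ge:
  fixes X :: "real set"
  assumes "finite X" "card X \<le> m"
  shows "m \<le> card {i. i < 2 * m \<and> (\<forall>x\<in>X. x / w - 2 * real i \<notin> {0..1})}"
    (is "_ \<le> card ?A")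
proof -
  have "{..<2 * m} - ?A \<subseteq> (\<lambda>x. nat \<lfloor>x / w / 2\<rfloor>) ` X"
  proof
    fix i assume "i \<in> {..<2 * m} - ?A"
    then obtain x where x: "x \<in> X" "x / w - 2 * real i \<in> {0..1}" by auto
    have "\<lfloor>x / w / 2\<rfloor> = int i"
      using x(2) by (intro floor_unique) auto
    then have "i = nat \<lfloor>x / w / 2\<rfloor>" by simp
    with x(1) show "i \<in> (\<lambda>x. nat \<lfloor>x / w / 2\<rfloor>) ` X" by blast
  qed
  then have "card ({..<2 * m} - ?A) \<le> m"
    using assms surj_card_le order_trans by blast
  moreover have "?A \<subseteq> {..<2 * m}" by auto
  then have "card ({..<2 * m} - ?A) = 2 * m - card ?A"
    by (subst card_Diff_subset) (auto intro: finite_subset)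
  ultimately show ?thesis by linarith
qed

section \<open>The discretization bound\<close>

text \<open>
  Coordinate 0 of the solution is time multiplied by \<open>c\<close>, so coordinate 1 is found by integration.
\<close>

lemma ivp_sol_ridge:
  fixes e :: "nat \<Rightarrow> 'a::banach"
  assumes sb: "schauder_basis e" and cont: "continuous_on UNIV H"
  shows "ivp_sol (\<lambda>y. c *\<^sub>R e 0 + H (coord e y 0) *\<^sub>R e 1) a b 0
    (\<lambda>s. (c * (s - a)) *\<^sub>R e 0 + integral {a..s} (\<lambda>\<sigma>. H (c * (\<sigma> - a))) *\<^sub>R e 1)"
  (is "ivp_sol ?f a b 0 ?z")
  unfolding ivp_sol_def
proof (intro conjI ballI)
  show "?z a = 0" by simp
next
  fix s assume s: "s \<in> {a..b}"
  have "continuous_on {a..b} (\<lambda>\<sigma>. H (c * (\<sigma> - a)))"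
    by (intro continuous_intros continuous_on_compose2[OF cont]) auto
  then have "((\<lambda>s. integral {a..s} (\<lambda>\<sigma>. H (c * (\<sigma> - a)))) has_vector_derivative H (c * (s - a)))
      (at s within {a..b})"
    using s by (rule integral_has_vector_derivative)
  then have "((\<lambda>s. integral {a..s} (\<lambda>\<sigma>. H (c * (\<sigma> - a)))) has_real_derivative H (c * (s - a)))
      (at s within {a..b})"
    by (simp add: has_real_derivative_iff_has_vector_derivative)
  then have "((\<lambda>s. integral {a..s} (\<lambda>\<sigma>. H (c * (\<sigma> - a))) *\<^sub>R e 1) has_vector_derivative
      H (c * (s - a)) *\<^sub>R e 1) (at s within {a..b})"
    by (auto intro!: derivative_eq_intros)
  moreover have "((\<lambda>s. (c * (s - a)) *\<^sub>R e 0) has_vector_derivative c *\<^sub>R e 0) (at s within {a..b})"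
    by (auto intro!: derivative_eq_intros)
  ultimately have "(?z has_vector_derivative c *\<^sub>R e 0 + H (c * (s - a)) *\<^sub>R e 1) (at s within {a..b})"
    by (intro has_vector_derivative_add)
  moreover have "coord e (?z s) 0 = c * (s - a)"
    by (simp add: coord_add[OF sb] coord_scaleR[OF sb] coord_basis[OF sb])
  ultimately show "(?z has_vector_derivative ?f (?z s)) (at s within {a..b})"
    by simp
qed

text \<open>
  The unperturbed constant problem is run first; its information points determine the free cells on
  which the perturbation is placed.  The assumption on \<open>\<epsilon>\<close> bounds all derivatives of the comb up to
  order \<open>q\<close>, including the first one that serves as a Lipschitz constant when \<open>r = 0\<close>, and the
  assumption \<open>M / 2 * (b - a) \<le> real n\<close> makes the cell width at most 1, so that the lower derivatives
  obey the same bound.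
\<close>

lemma worst_case_error_ge_discretization:
  fixes e :: "nat \<Rightarrow> 'a::banach" and K n :: nat
  assumes sb: "schauder_basis e" and nrm: "\<And>j. norm (e j) = 1"
    and B: "\<And>y. \<bar>coord e y 0\<bar> \<le> B * norm y" "0 \<le> B"
    and "a < b" "0 \<le> L" "0 < M" "0 \<le> D"
    and "positive_seq \<gamma>" "positive_seq \<delta>"
    and q: "q = max r 1"
    and "0 < \<epsilon>"
    and \<epsilon>: "\<epsilon> * (real (2 * Suc q) * (B + 1)) ^ q \<le> min (min L D) (min (\<delta> 1) (M / 2))"
    and "1 \<le> N" "1 \<le> K" "1 \<le> n" "m \<le> real (K * n)" "M / 2 * (b - a) \<le> real n"
    and adm: "admissible_information e r N m (problem_class e r L M D \<gamma> \<delta> R) S"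
  shows "ereal (\<epsilon> * (1/16) ^ Suc q * (M / 2 * (b - a) / real (4 * K)) ^ q * ((b - a) / 16) / real n ^ q)
      \<le> worst_case_error e a b n t N (problem_class e r L M D \<gamma> \<delta> R) S \<phi>"
proof -
  define F where "F = problem_class e r L M D \<gamma> \<delta> R"
  (* Half of M drives the clock, the other half is left for the perturbation. *)
  define c where "c = M / 2"
  (* The factor 4 = 2 * 2: there are 2 * (K * n) cells, each followed by a gap of the same length. *)
  define h where "h = (b - a) / real (4 * (K * n))"
  define w where "w = c * h"
  have pos: "0 < \<gamma> k" "0 < \<delta> k" if "1 \<le> k" for k
    using assms that unfolding positive_seq_def by auto
  have "0 < c" using \<open>0 < M\<close> by (simp add: c_def)
  have Kn: "1 \<le> K * n" using \<open>1 \<le> K\<close> \<open>1 \<le> n\<close> by simp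
  have "0 < h" using Kn \<open>a < b\<close> by (simp add: h_def)
  then have "0 < w" using \<open>0 < c\<close> by (simp add: w_def)
  have "w \<le> 1"
  proof -
    have "real n \<le> real (4 * (K * n))" using \<open>1 \<le> K\<close> by (simp flip: of_nat_mult)
    then have "c * (b - a) \<le> real (4 * (K * n))" using assms(18) unfolding c_def by linarith
    then show ?thesis using Kn by (simp add: w_def h_def)
  qed
  have "r \<le> q" "1 \<le> q" using q by auto
  define f where "f = (\<lambda>y::'a. c *\<^sub>R e 0)"
  have f_class: "(f, 0) \<in> F"
    unfolding f_def F_def
  proof (rule constant_in_problem_class[OF sb nrm B \<open>0 \<le> L\<close> \<open>0 \<le> D\<close>])
    fix k :: nat assume "1 \<le> k"
    then show "norm (0 - proj e k 0) \<le> \<gamma> k"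
      using pos(1)[of k] linear_0[OF linear_proj[OF sb]] by simp
    show "norm (c *\<^sub>R e 0 - proj e k (c *\<^sub>R e 0)) \<le> \<delta> k"
      unfolding proj_basis[OF sb] using \<open>1 \<le> k\<close> pos(2)[of k] by simp
  qed (use \<open>0 < M\<close> in \<open>simp add: nrm c_def\<close>)
  define Q where "Q = set (strategy_queries e N f (S (proj e N 0)))"
  (* The clock readings of the information points; functions of coordinate 0 see nothing else. *)
  define X where "X = (\<lambda>y. coord e (proj e N y) 0) ` fst ` Q"
  define A where "A = {i. i < 2 * (K * n) \<and> (\<forall>x\<in>X. x / w - 2 * real i \<notin> {0..1})}"
  have "finite A" unfolding A_def by simp
  have "finite X" unfolding X_def Q_def by simp
  have "real (card (fst ` Q)) \<le> m"
    using adm f_class unfolding admissible_information_def F_def Q_def Let_def by blast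
  then have "card (fst ` Q) \<le> K * n"
    using assms(17) by linarith
  then have "card X \<le> K * n"
    unfolding X_def using card_image_le[of "fst ` Q"] Q_def by (metis List.finite_set finite_imageI order_trans)
  then have cardA: "K * n \<le> card A"
    unfolding A_def by (rule card_free_cells_ge[OF \<open>finite X\<close>])
  define H where "H = comb \<epsilon> w q A"
  define g where "g = (\<lambda>y. c *\<^sub>R e 0 + H 0 (coord e y 0) *\<^sub>R e 1)"
  let ?Q = "(real (2 * Suc q) * (B + 1)) ^ q"
  have bound: "\<bar>H l x\<bar> * B ^ l \<le> \<epsilon> * ?Q" if "l \<le> q" for l x
  proof -
    have "\<bar>H l x\<bar> \<le> \<epsilon> * real (2 * Suc q) ^ l"
      unfolding H_def using \<open>finite A\<close> \<open>0 < \<epsilon>\<close> \<open>0 < w\<close> \<open>w \<le> 1\<close> that by (intro abs_comb_le) auto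
    moreover have "B ^ l \<le> (B + 1) ^ l"
      using B(2) by (intro power_mono) auto
    ultimately have "\<bar>H l x\<bar> * B ^ l \<le> \<epsilon> * real (2 * Suc q) ^ l * (B + 1) ^ l"
      using B(2) \<open>0 < \<epsilon>\<close> by (intro mult_mono) auto
    also have "\<dots> = \<epsilon> * (real (2 * Suc q) * (B + 1)) ^ l"
      by (simp add: power_mult_distrib)
    also have "\<dots> \<le> \<epsilon> * ?Q"
    proof (intro mult_left_mono power_increasing that)
      have "1 * 1 \<le> real (2 * Suc q) * (B + 1)"
        using B(2) by (intro mult_mono) auto
      then show "1 \<le> real (2 * Suc q) * (B + 1)" by simp
    qed (use \<open>0 < \<epsilon>\<close> in simp)
    finally show ?thesis .
  qed
  have H0: "\<bar>H 0 x\<bar> \<le> \<delta> 1" "\<bar>H 0 x\<bar> \<le> M / 2" for x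
    using bound[of 0 x] \<epsilon> by auto
  have derH: "(H l has_real_derivative H (Suc l) x) (at x)" if "l < q" for l x
    unfolding H_def by (rule has_real_derivative_comb[OF \<open>0 < w\<close> that])
  have contH: "continuous_on UNIV (H l)" for l
    unfolding H_def using \<open>0 < w\<close> by (intro continuous_on_comb) simp
  have g_class: "(g, 0) \<in> F"
    unfolding g_def F_def
  proof (rule ridge_in_problem_class[OF sb nrm B])
    fix l x assume "l < r"
    then show "(H l has_real_derivative H (Suc l) x) (at x)"
      using \<open>r \<le> q\<close> by (intro derH) simp
  next
    fix l x assume "l \<in> {1..r}"
    then show "\<bar>H l x\<bar> * B ^ l \<le> D"
      using bound[of l x] \<open>r \<le> q\<close> \<epsilon> by simp
  next
    fix x y
    (* Multiplying by B before applying the mean value bound covers the case B = 0. *)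
    have "norm (H 0 x * B - H 0 y * B) \<le> L * norm (x - y)"
    proof (rule field_differentiable_bound[of UNIV "\<lambda>x. H 0 x * B" "\<lambda>x. H 1 x * B"])
      fix z
      show "((\<lambda>x. H 0 x * B) has_field_derivative H 1 z * B) (at z within UNIV)"
        using derH[of 0 z] \<open>1 \<le> q\<close> by (intro DERIV_cmult_right) simp
      show "norm (H 1 z * B) \<le> L"
        using bound[of 1 z] \<open>1 \<le> q\<close> B(2) \<epsilon> by (simp add: abs_mult)
    qed auto
    then show "\<bar>H 0 x - H 0 y\<bar> * B \<le> L * \<bar>x - y\<bar>"
      using B(2) by (simp add: abs_mult flip: left_diff_distrib)
  next
    fix k :: nat assume "1 \<le> k"
    then show "norm (0 - proj e k 0) \<le> \<gamma> k"
      using pos(1)[of k] linear_0[OF linear_proj[OF sb]] by simp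
    fix x
    have "proj e k (c *\<^sub>R e 0 + H 0 x *\<^sub>R e 1) = c *\<^sub>R e 0 + (if 1 < k then H 0 x *\<^sub>R e 1 else 0)"
      using \<open>1 \<le> k\<close> by (simp add: linear_add[OF linear_proj[OF sb]] proj_basis[OF sb])
    then show "norm (c *\<^sub>R e 0 + H 0 x *\<^sub>R e 1 - proj e k (c *\<^sub>R e 0 + H 0 x *\<^sub>R e 1)) \<le> \<delta> k"
      using \<open>1 \<le> k\<close> pos(2)[of k] H0(1)[of x] nrm by (cases "k = 1") auto
  next
    fix x
    show "norm (c *\<^sub>R e 0 + H 0 x *\<^sub>R e 1) \<le> M"
      using norm_triangle_ineq[of "c *\<^sub>R e 0" "H 0 x *\<^sub>R e 1"] H0(2)[of x] \<open>0 < c\<close>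
      by (simp add: nrm c_def)
  qed (use contH \<open>0 \<le> L\<close> in auto)
  (* Closed cells are excluded, so that W is open and contains neighbourhoods of the information
     points, on which f and g agree: all their partial derivatives agree there as well. *)
  define W where "W = (\<Inter>i\<in>A. (\<lambda>y. coord e y 0 / w - 2 * real i) -` (- {0..1}))"
  have "bounded_linear (\<lambda>y. coord e y 0)"
    using B(1)
    by (intro bounded_linear_intro[of _ B])
       (simp_all add: coord_add[OF sb] coord_scaleR[OF sb] mult.commute)
  then have "continuous_on UNIV (\<lambda>y. coord e y 0)"
    by (rule linear_continuous_on)
  then have "open W"
    unfolding W_def using \<open>finite A\<close> \<open>0 < w\<close>
    by (intro open_INT ballI open_vimage continuous_intros) auto
  have fg: "f y = g y" if "y \<in> W" for y
  proof -
    have "H 0 (coord e y 0) = 0"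
      unfolding H_def by (rule comb_eq_0) (use that in \<open>auto simp: W_def\<close>)
    then show ?thesis by (simp add: f_def g_def)
  qed
  have info: "information e N S f 0 = information e N S g 0"
  proof (rule information_cong)
    fix u assume u: "u \<in> set (strategy_queries e N f (S (proj e N 0)))"
    obtain y j js where [simp]: "u = (y, j, js)" by (cases u) auto
    have "coord e (proj e N y) 0 \<in> X"
      using u unfolding X_def Q_def by force
    then have "proj e N y \<in> W"
      unfolding W_def A_def by auto
    then have "partial_deriv e js (\<lambda>x. coord e (f x) j) (proj e N y)
        = partial_deriv e js (\<lambda>x. coord e (g x) j) (proj e N y)"
      by (intro partial_deriv_cong_open[OF \<open>open W\<close>]) (simp_all add: fg)
    then show "eval_result e N f u = eval_result e N g u" by simp
  qed simp
  let ?I = "integral {a..b} (\<lambda>\<sigma>. H 0 (c * (\<sigma> - a)))"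
  have "ereal (norm ((0 + (b - a) *\<^sub>R (c *\<^sub>R e 0)) - ((c * (b - a)) *\<^sub>R e 0 + ?I *\<^sub>R e 1)) / 2)
      \<le> worst_case_error e a b n t N F S \<phi>"
    using worst_case_error_ge_half_distance[OF f_class g_class info
        ivp_sol_constant[of "c *\<^sub>R e 0" a b 0, folded f_def]
        ivp_sol_ridge[OF sb contH[of 0], of c a b, folded g_def], of b]
      \<open>a < b\<close> by simp
  moreover have "(0 + (b - a) *\<^sub>R (c *\<^sub>R e 0)) - ((c * (b - a)) *\<^sub>R e 0 + ?I *\<^sub>R e 1) = - ?I *\<^sub>R e 1"
    by (simp add: mult.commute)
  then have "norm ((0 + (b - a) *\<^sub>R (c *\<^sub>R e 0)) - ((c * (b - a)) *\<^sub>R e 0 + ?I *\<^sub>R e 1)) = \<bar>?I\<bar>"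
    by (simp only: norm_scaleR nrm)
  ultimately have err: "ereal (\<bar>?I\<bar> / 2) \<le> worst_case_error e a b n t N F S \<phi>"
    by (simp only:)
  have hm: "h * real (K * n) = (b - a) / 4"
    using Kn by (simp add: h_def)
  have "\<epsilon> * w ^ q * (real (K * n) * ((1/16) ^ Suc q * (h / 2)))
      \<le> \<epsilon> * w ^ q * (real (card A) * ((1/16) ^ Suc q * (h / 2)))"
    using cardA \<open>0 < \<epsilon>\<close> \<open>0 < w\<close> \<open>0 < h\<close>
    by (intro mult_left_mono mult_right_mono) (auto simp del: of_nat_mult)
  also have "\<dots> \<le> ?I"
    unfolding H_def w_def
  proof (rule integral_comb_ge[OF \<open>0 < h\<close> \<open>0 < c\<close> _ \<open>finite A\<close>])
    show "A \<subseteq> {..<2 * (K * n)}" unfolding A_def by auto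
    show "a + 2 * real (2 * (K * n)) * h \<le> b" using hm by (simp add: algebra_simps)
  qed (use \<open>0 < \<epsilon>\<close> in simp)
  finally have I: "\<epsilon> * w ^ q * ((1/16) ^ Suc q * (h * real (K * n) / 2)) \<le> ?I"
    by (simp add: algebra_simps)
  have "w = M / 2 * (b - a) / real (4 * K) / real n"
    using \<open>1 \<le> K\<close> \<open>1 \<le> n\<close> by (simp add: w_def h_def c_def field_simps)
  then have wq: "w ^ q = (M / 2 * (b - a) / real (4 * K)) ^ q / real n ^ q"
    by (simp only: power_divide)
  have rearrange: "\<epsilon> * u * v * (d / 16) / x = \<epsilon> * (v / x) * (u * (d / 4 / 2)) / 2" for u v d x :: real
    by simp
  have "\<epsilon> * (1/16) ^ Suc q * (M / 2 * (b - a) / real (4 * K)) ^ q * ((b - a) / 16) / real n ^ q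
      = \<epsilon> * w ^ q * ((1/16) ^ Suc q * (h * real (K * n) / 2)) / 2"
    unfolding hm wq by (rule rearrange)
  also have "\<dots> \<le> \<bar>?I\<bar> / 2"
    using I by linarith
  finally have "ereal (\<epsilon> * (1/16) ^ Suc q * (M / 2 * (b - a) / real (4 * K)) ^ q * ((b - a) / 16) / real n ^ q)
      \<le> ereal (\<bar>?I\<bar> / 2)" by (simp only: ereal_less_eq)
  also note err
  finally show ?thesis unfolding F_def .
qed

section \<open>The lower bound\<close>

lemma nonincreasing_null_antimono:
  assumes "nonincreasing_null s" "1 \<le> i" "i \<le> k"
  shows "s k \<le> s i"
  using assms(3)
proof (induction k rule: dec_induct)
  case base
  then show ?case by simp
next
  case (step k)
  then show ?case
    using assms(1,2) unfolding nonincreasing_null_def by (meson order_trans)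
qed

lemma ereal_scaled_sum_le:
  assumes "0 \<le> c1" "0 \<le> c2" "0 \<le> c3" "0 \<le> x" "0 \<le> y" "0 \<le> z"
    and "ereal (c1 * x) \<le> E" "ereal (c2 * y) \<le> E" "ereal (c3 * z) \<le> E"
  shows "ereal (min c1 (min c2 c3) / 3 * (x + y + z)) \<le> E"
proof -
  let ?c = "min c1 (min c2 c3)"
  let ?m = "max (c1 * x) (max (c2 * y) (c3 * z))"
  have "?c * x \<le> c1 * x" "?c * y \<le> c2 * y" "?c * z \<le> c3 * z"
    by (intro mult_right_mono; use assms in simp)+
  then have "?c / 3 * (x + y + z) \<le> ?m"
    by (simp add: algebra_simps max_def)
  then have "ereal (?c / 3 * (x + y + z)) \<le> ereal ?m" by (simp only: ereal_less_eq)
  also have "\<dots> \<le> E" using assms(7-9) by (auto simp: max_def)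
  finally show ?thesis .
qed

theorem theorem2:
  fixes e :: "nat \<Rightarrow> 'a::banach"
    and r :: nat
    and a b L M D P R :: real
    and \<gamma> \<delta> :: "nat \<Rightarrow> real"
  assumes "schauder_basis e" and "\<And>j. norm (e j) = 1"
    and "basis_constant e P"
    and "a < b"
    and "0 < L" and "0 < M" and "0 < D"
    and "positive_seq \<gamma>" and "nonincreasing_null \<gamma>"
    and "positive_seq \<delta>" and "nonincreasing_null \<delta>"
    and "confining_radius e r a b L M \<gamma> R"
  shows "\<forall>Khat Khat1 :: real. \<exists>(C::real) (n0::nat) (N0::nat). 0 < C \<and> 0 < n0 \<and> 0 < N0 \<and>
    (\<forall>n\<ge>n0. \<forall>N\<ge>N0. \<forall>(\<alpha>::nat \<Rightarrow> real) (t::nat \<Rightarrow> real)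
        (S::'a \<Rightarrow> 'a strategy) (\<phi>::'a \<times> real list \<Rightarrow> nat \<Rightarrow> real \<Rightarrow> 'a).
       nonincreasing_null \<alpha> \<and> (\<forall>m\<ge>1. \<alpha> m \<le> Khat1 / real m) \<and>
       is_partition a b n t \<and> mesh_le n t (\<alpha> n) \<and>
       admissible_information e r N (Khat * real n) (problem_class e r L M D \<gamma> \<delta> R) S \<longrightarrow>
       ereal (C * (\<gamma> N + \<delta> N + 1 / real n ^ max r 1))
         \<le> worst_case_error e a b n t N (problem_class e r L M D \<gamma> \<delta> R) S \<phi>)"
proof (intro allI)
  fix Khat Khat1 :: real
  obtain B where B: "\<And>y. \<bar>coord e y 0\<bar> \<le> B * norm y" "0 \<le> B"
    using coord_first_bounded[OF assms(1) assms(2) assms(3)] by blast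
  define q where "q = max r 1"
  (* An integer K is needed to count cells; it must be positive even when Khat is not. *)
  define K where "K = max 1 (nat \<lceil>Khat\<rceil>)"
  have K: "1 \<le> K" "Khat \<le> real K" unfolding K_def by (simp, linarith)
  have \<delta>1: "0 < \<delta> 1" using assms(10) unfolding positive_seq_def by simp
  let ?Q = "(real (2 * Suc q) * (B + 1)) ^ q"
  have "0 < ?Q" using B(2) by simp
  define \<epsilon> where "\<epsilon> = min (min L D) (min (\<delta> 1) (M / 2)) / ?Q"
  have "0 < \<epsilon>" unfolding \<epsilon>_def using \<open>0 < ?Q\<close> assms \<delta>1 by simp
  have \<epsilon>: "\<epsilon> * ?Q \<le> min (min L D) (min (\<delta> 1) (M / 2))"
    unfolding \<epsilon>_def using \<open>0 < ?Q\<close>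
    by (metis nonzero_eq_divide_eq less_irrefl order_refl)
  define c2 where "c2 = (b - a) * min 1 (M / \<delta> 1)"
  define c3 where "c3 = \<epsilon> * (1/16) ^ Suc q * (M / 2 * (b - a) / real (4 * K)) ^ q * ((b - a) / 16)"
  have c: "0 < c2" "0 < c3"
    unfolding c2_def c3_def using assms \<delta>1 \<open>0 < \<epsilon>\<close> K(1) by simp_all
  define n0 where "n0 = max 1 (nat \<lceil>M / 2 * (b - a)\<rceil>)"
  show "\<exists>(C::real) (n0::nat) (N0::nat). 0 < C \<and> 0 < n0 \<and> 0 < N0 \<and>
    (\<forall>n\<ge>n0. \<forall>N\<ge>N0. \<forall>(\<alpha>::nat \<Rightarrow> real) (t::nat \<Rightarrow> real)
        (S::'a \<Rightarrow> 'a strategy) (\<phi>::'a \<times> real list \<Rightarrow> nat \<Rightarrow> real \<Rightarrow> 'a).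
       nonincreasing_null \<alpha> \<and> (\<forall>m\<ge>1. \<alpha> m \<le> Khat1 / real m) \<and>
       is_partition a b n t \<and> mesh_le n t (\<alpha> n) \<and>
       admissible_information e r N (Khat * real n) (problem_class e r L M D \<gamma> \<delta> R) S \<longrightarrow>
       ereal (C * (\<gamma> N + \<delta> N + 1 / real n ^ max r 1))
         \<le> worst_case_error e a b n t N (problem_class e r L M D \<gamma> \<delta> R) S \<phi>)"
  proof (intro exI conjI allI impI)
    show "0 < min 1 (min c2 c3) / 3" "0 < n0" "0 < (1::nat)"
      using c by (auto simp: n0_def)
  next
    fix n N :: nat and \<alpha> t :: "nat \<Rightarrow> real" and S :: "'a \<Rightarrow> 'a strategy"
      and \<phi> :: "'a \<times> real list \<Rightarrow> nat \<Rightarrow> real \<Rightarrow> 'a"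
    assume n: "n0 \<le> n" and N: "1 \<le> N"
      and asm: "nonincreasing_null \<alpha> \<and> (\<forall>m\<ge>1. \<alpha> m \<le> Khat1 / real m) \<and>
       is_partition a b n t \<and> mesh_le n t (\<alpha> n) \<and>
       admissible_information e r N (Khat * real n) (problem_class e r L M D \<gamma> \<delta> R) S"
    then have adm: "admissible_information e r N (Khat * real n) (problem_class e r L M D \<gamma> \<delta> R) S"
      by blast
    let ?E = "worst_case_error e a b n t N (problem_class e r L M D \<gamma> \<delta> R) S \<phi>"
    have n': "1 \<le> n" "M / 2 * (b - a) \<le> real n"
      using n unfolding n0_def by (simp, linarith)
    have pts: "Khat * real n \<le> real (K * n)"
      using K(2) by (simp add: mult_right_mono)
    have le: "0 \<le> L" "0 \<le> M" "0 \<le> D" using assms by auto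
    have "ereal (1 * \<gamma> N) \<le> ?E"
      using worst_case_error_ge_initial_tail[OF assms(1,2) B assms(4) le assms(8)
          nonincreasing_null_antimono[OF assms(9)] assms(10) N] by simp
    moreover have "ereal (c2 * \<delta> N) \<le> ?E"
      unfolding c2_def
      by (rule worst_case_error_ge_rhs_tail[OF assms(1,2) B assms(4) le assms(8,10)
            nonincreasing_null_antimono[OF assms(11)] N adm])
    moreover have "ereal (c3 * (1 / real n ^ max r 1)) \<le> ?E"
      using worst_case_error_ge_discretization[OF assms(1,2) B assms(4) le(1) assms(6) le(3)
          assms(8,10) q_def \<open>0 < \<epsilon>\<close> \<epsilon> N K(1) n'(1) pts n'(2) adm]
      by (simp add: c3_def q_def)
    moreover have "0 \<le> \<gamma> N" "0 \<le> \<delta> N"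
      using assms(8,10) N unfolding positive_seq_def by (simp_all add: less_imp_le)
    ultimately show "ereal (min 1 (min c2 c3) / 3 * (\<gamma> N + \<delta> N + 1 / real n ^ max r 1)) \<le> ?E"
      using c by (intro ereal_scaled_sum_le) auto
  qed
qed

end
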